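(* Let $M$ be a countable transitive model of (a sufficiently large fragment of) ZFC, let $\mathbb B\in M$ be such that in $M$, $\mathbb B$ is a complete Boolean algebra which is rigid, and suppose that $\dot x\in M$ is a $\mathbb B$-name such that for every $\mathbb B$-generic filter $G$ over $M$, $x_G:=\dot x^G\in\omega^\omega$ and $M[G]=M[x_G]$. Then for any two $\mathbb B$-generic filters $G,H$ over $M$, $$M[x_G]=M[x_H]\quad\Longleftrightarrow\quad x_G=x_H\quad\Longleftrightarrow\quad x_G\,E_0\,x_H .$$ In particular, for all such $G,H$: $M[x_G]=M[x_H]$ if and only if there is $N<\omega$ such that $x_G(n)=x_H(n)$ for all $n>N$.
   Context: A complete Boolean algebra is rigid if it has no automorphism other than the identity. For $x,y\in\omega^\omega$, $x\,E_0\,y$ means that $x(n)=y(n)$ for all but finitely many $n<\omega$. *)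

theory Defs
  imports "HOL-Library.Countable_Set_Type" "HOL-Library.Infinite_Set" "HOL-Algebra.Lattice"
begin

section \<open>Hereditarily countable sets\<close>

text \<open>
  The members of a countable transitive set are hereditarily countable, and so are the members of
  its generic extensions. The datatype below is therefore a large enough universe: countable
  transitive models are countable transitive subsets of it. Extensionality is injectivity of the
  constructor, and foundation is structural induction.
\<close>

datatype hc = HC (cset_of: "hc cset")

definition elems :: "hc \<Rightarrow> hc set" where
  "elems x = rcset (cset_of x)"

text \<open>Only meaningful for countable arguments.\<close>

definition hset :: "hc set \<Rightarrow> hc" where
  "hset X = HC (acset X)"

lemma countable_elems [simp, intro]: "countable (elems x)"
  by (simp add: elems_def)

lemma elems_hset [simp]: "countable X \<Longrightarrow> elems (hset X) = X"
  by (simp add: elems_def hset_def)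

lemma hset_elems [simp]: "hset (elems x) = x"
  by (simp add: elems_def hset_def)

lemma hc_extensionality: "x = y \<longleftrightarrow> elems x = elems y"
  by (metis hset_elems)

lemma hc_mem_induct: "(\<And>x. (\<And>y. y \<in> elems x \<Longrightarrow> P y) \<Longrightarrow> P x) \<Longrightarrow> P x"
  by (induction x) (metis elems_def hc.sel)

definition mem_rel :: "(hc \<times> hc) set" where
  "mem_rel = {(x, y). x \<in> elems y}"

lemma wf_mem_rel: "wf mem_rel"
  unfolding wf_def mem_rel_def using hc_mem_induct by auto

definition kpair :: "hc \<Rightarrow> hc \<Rightarrow> hc" where
  "kpair x y = hset {hset {x}, hset {x, y}}"

lemma kpair_inject [simp]: "kpair x y = kpair x' y' \<longleftrightarrow> x = x' \<and> y = y'"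
proof -
  have "hset X = hset Y \<longleftrightarrow> X = Y" if "countable X" "countable Y" for X Y
    using that by (metis elems_hset)
  then show ?thesis
    by (auto simp: kpair_def doubleton_eq_iff)
qed

lemma kpair_mem_trancl: "(x, kpair x y) \<in> mem_rel\<^sup>+"
proof -
  have "(x, hset {x}) \<in> mem_rel" "(hset {x}, kpair x y) \<in> mem_rel"
    by (simp_all add: mem_rel_def kpair_def)
  then show ?thesis by (meson trancl.simps)
qed

fun nat_hc :: "nat \<Rightarrow> hc" where
  "nat_hc 0 = hset {}"
| "nat_hc (Suc n) = hset (insert (nat_hc n) (elems (nat_hc n)))"

definition omega :: hc where
  "omega = hset (range nat_hc)"

definition is_function :: "hc \<Rightarrow> hc \<Rightarrow> hc \<Rightarrow> bool" where
  "is_function f X Y \<longleftrightarrow>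
     (\<forall>z\<in>elems f. \<exists>x\<in>elems X. \<exists>y\<in>elems Y. z = kpair x y) \<and>
     (\<forall>x\<in>elems X. \<exists>!y. kpair x y \<in> elems f)"

definition app :: "hc \<Rightarrow> hc \<Rightarrow> hc" where
  "app f x = (THE y. kpair x y \<in> elems f)"

definition baire :: "hc set" where
  "baire = {x. is_function x omega omega}"

definition E0 :: "hc \<Rightarrow> hc \<Rightarrow> bool" where
  "E0 x y \<longleftrightarrow> (\<forall>\<^sub>\<infinity>n. app x (nat_hc n) = app y (nat_hc n))"


section \<open>The language of set theory and the axioms of ZFC\<close>

text \<open>Variables are named by natural numbers.\<close>

datatype fm =
    Mem nat nat
  | Eq nat nat
  | Neg fm
  | Conj fm fm
  | All nat fm

abbreviation Disj :: "fm \<Rightarrow> fm \<Rightarrow> fm" where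
  "Disj p q \<equiv> Neg (Conj (Neg p) (Neg q))"

abbreviation Imp :: "fm \<Rightarrow> fm \<Rightarrow> fm" where
  "Imp p q \<equiv> Neg (Conj p (Neg q))"

abbreviation Iff :: "fm \<Rightarrow> fm \<Rightarrow> fm" where
  "Iff p q \<equiv> Conj (Imp p q) (Imp q p)"

abbreviation Ex :: "nat \<Rightarrow> fm \<Rightarrow> fm" where
  "Ex n p \<equiv> Neg (All n (Neg p))"

fun fv :: "fm \<Rightarrow> nat set" where
  "fv (Mem i j) = {i, j}"
| "fv (Eq i j) = {i, j}"
| "fv (Neg p) = fv p"
| "fv (Conj p q) = fv p \<union> fv q"
| "fv (All n p) = fv p - {n}"

text \<open>Satisfaction in the structure \<open>(M, \<in>)\<close> under the assignment \<open>s\<close>.\<close>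

fun sat :: "hc set \<Rightarrow> (nat \<Rightarrow> hc) \<Rightarrow> fm \<Rightarrow> bool" where
  "sat M s (Mem i j) \<longleftrightarrow> s i \<in> elems (s j)"
| "sat M s (Eq i j) \<longleftrightarrow> s i = s j"
| "sat M s (Neg p) \<longleftrightarrow> \<not> sat M s p"
| "sat M s (Conj p q) \<longleftrightarrow> sat M s p \<and> sat M s q"
| "sat M s (All n p) \<longleftrightarrow> (\<forall>a\<in>M. sat M (s(n := a)) p)"

text \<open>Free variables are read universally, so the schemes below come with parameters.\<close>

definition models :: "hc set \<Rightarrow> fm set \<Rightarrow> bool" where
  "models M T \<longleftrightarrow> M \<noteq> {} \<and> (\<forall>p\<in>T. \<forall>s. range s \<subseteq> M \<longrightarrow> sat M s p)"

definition Extensionality :: fm where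
  "Extensionality = All 0 (All 1 (Imp (All 2 (Iff (Mem 2 0) (Mem 2 1))) (Eq 0 1)))"

definition Foundation :: fm where
  "Foundation =
     All 0 (Imp (Ex 1 (Mem 1 0)) (Ex 1 (Conj (Mem 1 0) (Neg (Ex 2 (Conj (Mem 2 1) (Mem 2 0)))))))"

definition Pairing :: fm where
  "Pairing = All 0 (All 1 (Ex 2 (All 3 (Iff (Mem 3 2) (Disj (Eq 3 0) (Eq 3 1))))))"

definition Union_ax :: fm where
  "Union_ax = All 0 (Ex 1 (All 2 (Iff (Mem 2 1) (Ex 3 (Conj (Mem 3 0) (Mem 2 3))))))"

definition Power_set :: fm where
  "Power_set = All 0 (Ex 1 (All 2 (Iff (Mem 2 1) (All 3 (Imp (Mem 3 2) (Mem 3 0))))))"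

definition Infinity :: fm where
  "Infinity =
     Ex 0 (Conj (Ex 1 (Conj (Mem 1 0) (Neg (Ex 2 (Mem 2 1)))))
                (All 1 (Imp (Mem 1 0)
                   (Ex 2 (Conj (Mem 2 0) (All 3 (Iff (Mem 3 2) (Disj (Mem 3 1) (Eq 3 1)))))))))"

text \<open>Every family of nonempty pairwise disjoint sets has a transversal.\<close>

definition Choice :: fm where
  "Choice =
     All 0 (Imp (Conj (All 1 (Imp (Mem 1 0) (Ex 2 (Mem 2 1))))
                      (All 1 (All 2 (Imp (Conj (Conj (Mem 1 0) (Mem 2 0))
                                               (Ex 3 (Conj (Mem 3 1) (Mem 3 2))))
                                         (Eq 1 2)))))
                (Ex 1 (All 2 (Imp (Mem 2 0)
                   (Ex 3 (All 4 (Iff (Conj (Mem 4 2) (Mem 4 1)) (Eq 4 3))))))))"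

text \<open>
  In both schemes the formula speaks about the variable \<open>0\<close> (and \<open>1\<close>); the freshness conditions
  prevent capture of the quantified auxiliary variables, and cost no generality since
  the variables of a formula can be renamed.
\<close>

definition Separation :: "fm \<Rightarrow> fm" where
  "Separation p = All 1 (Ex 2 (All 0 (Iff (Mem 0 2) (Conj (Mem 0 1) p))))"

definition Replacement :: "fm \<Rightarrow> fm" where
  "Replacement p =
     All 2 (Imp (All 0 (Imp (Mem 0 2) (Ex 4 (All 1 (Imp p (Eq 1 4))))))
                (Ex 3 (All 1 (Iff (Mem 1 3) (Ex 0 (Conj (Mem 0 2) p))))))"

definition ZFC :: "fm set" where
  "ZFC = {Extensionality, Foundation, Pairing, Union_ax, Power_set, Infinity, Choice}
       \<union> {Separation p | p. 2 \<notin> fv p}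
       \<union> {Replacement p | p. 3 \<notin> fv p \<and> 4 \<notin> fv p}"

definition transitive_set :: "hc set \<Rightarrow> bool" where
  "transitive_set M \<longleftrightarrow> (\<forall>x\<in>M. elems x \<subseteq> M)"

definition ctm :: "fm set \<Rightarrow> hc set \<Rightarrow> bool" where
  "ctm T M \<longleftrightarrow> countable M \<and> transitive_set M \<and> models M T"

text \<open>
  \<open>M[x]\<close> is the least transitive model containing \<open>M\<close> and \<open>x\<close>, taken with respect to the axioms \<open>S\<close>.
  If there is a least one, the intersection is that model; if there is no such model at all,
  the intersection is the whole universe and is not a countable set. The axioms \<open>S\<close> may be a smaller
  fragment of ZFC than the one satisfied by \<open>M\<close>, because a generic extension of a model of a finite
  fragment is in general only a model of a smaller fragment.
\<close>

definition adjoin :: "fm set \<Rightarrow> hc set \<Rightarrow> hc \<Rightarrow> hc set" where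
  "adjoin S M x = \<Inter>{N. transitive_set N \<and> models N S \<and> M \<subseteq> N \<and> x \<in> N}"


section \<open>Boolean algebras in a model\<close>

text \<open>
  A Boolean algebra is given as an ordered set, coded by \<open>kpair A R\<close> with carrier \<open>A\<close> and ordering
  \<open>R \<subseteq> A \<times> A\<close>.
\<close>

definition ord_of :: "hc \<Rightarrow> hc \<Rightarrow> hc gorder" where
  "ord_of A R = \<lparr>carrier = elems A, eq = (=), le = (\<lambda>x y. kpair x y \<in> elems R)\<rparr>"

definition boolean_algebra_on :: "hc \<Rightarrow> hc \<Rightarrow> bool" where
  "boolean_algebra_on A R \<longleftrightarrow>
     (\<forall>z\<in>elems R. \<exists>x\<in>elems A. \<exists>y\<in>elems A. z = kpair x y) \<and>
     (let L = ord_of A R in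
        bounded_lattice L \<and>
        (\<forall>x\<in>carrier L. \<forall>y\<in>carrier L. \<forall>z\<in>carrier L.
           x \<sqinter>\<^bsub>L\<^esub> (y \<squnion>\<^bsub>L\<^esub> z) = (x \<sqinter>\<^bsub>L\<^esub> y) \<squnion>\<^bsub>L\<^esub> (x \<sqinter>\<^bsub>L\<^esub> z)) \<and>
        (\<forall>x\<in>carrier L. \<exists>y\<in>carrier L. x \<sqinter>\<^bsub>L\<^esub> y = \<bottom>\<^bsub>L\<^esub> \<and> x \<squnion>\<^bsub>L\<^esub> y = \<top>\<^bsub>L\<^esub>))"

text \<open>
  Relativizations to \<open>M\<close>: the quantifiers over subsets of the algebra and over maps range over \<open>M\<close>.
  The other quantifiers are bounded by the carrier and need no relativization in a transitive \<open>M\<close>.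
\<close>

definition complete_boolean_algebra_in :: "hc set \<Rightarrow> hc \<Rightarrow> hc \<Rightarrow> bool" where
  "complete_boolean_algebra_in M A R \<longleftrightarrow>
     boolean_algebra_on A R \<and>
     (\<forall>X\<in>M. elems X \<subseteq> elems A \<longrightarrow>
        (\<exists>s. least (ord_of A R) s (Upper (ord_of A R) (elems X))) \<and>
        (\<exists>i. greatest (ord_of A R) i (Lower (ord_of A R) (elems X))))"

definition automorphism :: "hc \<Rightarrow> hc \<Rightarrow> hc \<Rightarrow> bool" where
  "automorphism A R f \<longleftrightarrow>
     is_function f A A \<and> bij_betw (app f) (elems A) (elems A) \<and>
     (\<forall>x\<in>elems A. \<forall>y\<in>elems A. kpair x y \<in> elems R \<longleftrightarrow> kpair (app f x) (app f y) \<in> elems R)"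

definition rigid_in :: "hc set \<Rightarrow> hc \<Rightarrow> hc \<Rightarrow> bool" where
  "rigid_in M A R \<longleftrightarrow> (\<forall>f\<in>M. automorphism A R f \<longrightarrow> (\<forall>x\<in>elems A. app f x = x))"


section \<open>Generic extensions\<close>

definition filter_on :: "hc \<Rightarrow> hc \<Rightarrow> hc set \<Rightarrow> bool" where
  "filter_on A R G \<longleftrightarrow>
     (let L = ord_of A R in
        G \<subseteq> carrier L \<and> \<top>\<^bsub>L\<^esub> \<in> G \<and> \<bottom>\<^bsub>L\<^esub> \<notin> G \<and>
        (\<forall>x\<in>G. \<forall>y\<in>G. x \<sqinter>\<^bsub>L\<^esub> y \<in> G) \<and>
        (\<forall>x\<in>G. \<forall>y\<in>carrier L. x \<sqsubseteq>\<^bsub>L\<^esub> y \<longrightarrow> y \<in> G))"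

definition dense_in :: "hc \<Rightarrow> hc \<Rightarrow> hc set \<Rightarrow> bool" where
  "dense_in A R D \<longleftrightarrow>
     (let L = ord_of A R in
        D \<subseteq> carrier L - {\<bottom>\<^bsub>L\<^esub>} \<and>
        (\<forall>x\<in>carrier L - {\<bottom>\<^bsub>L\<^esub>}. \<exists>d\<in>D. d \<sqsubseteq>\<^bsub>L\<^esub> x))"

definition generic :: "hc set \<Rightarrow> hc \<Rightarrow> hc \<Rightarrow> hc set \<Rightarrow> bool" where
  "generic M A R G \<longleftrightarrow>
     filter_on A R G \<and> (\<forall>D\<in>M. dense_in A R (elems D) \<longrightarrow> elems D \<inter> G \<noteq> {})"

text \<open>\<open>A\<close> is the set of conditions.\<close>

inductive is_name :: "hc \<Rightarrow> hc \<Rightarrow> bool" for A where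
  "(\<And>z. z \<in> elems t \<Longrightarrow> \<exists>u p. z = kpair u p \<and> is_name A u \<and> p \<in> elems A) \<Longrightarrow> is_name A t"

function val :: "hc set \<Rightarrow> hc \<Rightarrow> hc" where
  "val G t = hset ((\<lambda>u. val G u) ` {u. \<exists>p\<in>G. kpair u p \<in> elems t})"
  by pat_completeness auto
termination
proof (relation "inv_image (mem_rel\<^sup>+) snd")
  show "wf (inv_image (mem_rel\<^sup>+) snd)"
    by (intro wf_inv_image wf_trancl wf_mem_rel)
next
  fix G :: "hc set" and t u :: hc
  assume "u \<in> {u. \<exists>p\<in>G. kpair u p \<in> elems t}"
  then obtain p where "(kpair u p, t) \<in> mem_rel"
    by (auto simp: mem_rel_def)
  then show "((G, u), (G, t)) \<in> inv_image (mem_rel\<^sup>+) snd"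
    using kpair_mem_trancl[of u p] by (auto intro: trancl_into_trancl)
qed

declare val.simps [simp del]

lemma elems_val: "elems (val G t) = val G ` {u. \<exists>p\<in>G. kpair u p \<in> elems t}"
proof -
  have "{u. \<exists>p\<in>G. kpair u p \<in> elems t} \<subseteq> (\<lambda>z. SOME u. \<exists>p. z = kpair u p) ` elems t"
  proof
    fix u assume "u \<in> {u. \<exists>p\<in>G. kpair u p \<in> elems t}"
    then obtain p where "kpair u p \<in> elems t" by blast
    moreover have "u = (SOME u'. \<exists>p'. kpair u p = kpair u' p')" by simp
    ultimately show "u \<in> (\<lambda>z. SOME u. \<exists>p. z = kpair u p) ` elems t"
      by (rule rev_image_eqI)
  qed
  then have "countable {u. \<exists>p\<in>G. kpair u p \<in> elems t}"
    by (rule countable_subset) (rule countable_image, rule countable_elems)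
  then show ?thesis
    by (subst val.simps) simp
qed

definition gen_ext :: "hc set \<Rightarrow> hc \<Rightarrow> hc set \<Rightarrow> hc set" where
  "gen_ext M A G = val G ` {t \<in> M. is_name A t}"

end

theory Submission
  imports Defs
begin

text \<open>
  If \<open>M[G] = M[H]\<close>, then \<open>H\<close> has a name in \<open>M[G]\<close> and \<open>G\<close> has a name in \<open>M[H]\<close>; taking Boolean
  values gives maps \<open>f, g \<in> M\<close> on the algebra with \<open>a \<in> H \<longleftrightarrow> f a \<in> G\<close> and \<open>b \<in> G \<longleftrightarrow> g b \<in> H\<close>. By
  genericity, below some \<open>p \<in> G\<close> and some \<open>q \<in> H\<close> these maps preserve meets and are inverse to each
  other. If \<open>G \<noteq> H\<close>, one can take \<open>p\<close> and \<open>q\<close> disjoint, and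
  \<open>b \<mapsto> (f b \<sqinter> p) \<squnion> (g b \<sqinter> q) \<squnion> (b - (p \<squnion> q))\<close> is an involutive automorphism in \<open>M\<close> that moves
  \<open>q\<close>, against rigidity. Conversely, a finite modification of a real lies in every transitive model
  containing the real, so \<open>E0\<close>-related reals generate the same model.
\<close>

section \<open>Definable predicates\<close>

text \<open>The theorem is about a finite fragment of ZFC, so every use of Separation or Replacement
  must come from a list fixed before the model is given; hence the explicit collection
  \<open>sep_preds\<close> and the work on definability. The forcing theorem is needed only for
  statements that a name denotes a given ground model set. This suffices because a generic filter is
  a subset of the ground model set \<open>A\<close>, so names for it can be tested one element of
  \<open>A\<close> at a time. A single condition can witness infinitely many identities between
  \<open>f\<close>, \<open>g\<close> and meets because the set of all these identities lies in
  \<open>M\<close>, although the filters need not. Generic filters are ultrafilters, so distinct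
  ones contain complementary elements; this is the source of disjoint \<open>p\<close> and
  \<open>q\<close>. These are then shrunk until \<open>p\<close> is below \<open>f q\<close> and
  \<open>q\<close> is below \<open>g p\<close>, which makes \<open>f\<close> and \<open>g\<close>
  induce mutually inverse isomorphisms between the parts of the algebra below \<open>q\<close> and
  below \<open>p\<close>.\<close>

lemma finite_fv [simp]: "finite (fv p)"
  by (induction p) auto

lemma sat_cong: "(\<And>i. i \<in> fv p \<Longrightarrow> s i = s' i) \<Longrightarrow> sat M s p \<longleftrightarrow> sat M s' p"
proof (induction p arbitrary: s s')
  case (All n p)
  have "sat M (s(n := a)) p \<longleftrightarrow> sat M (s'(n := a)) p" for a
    by (rule All.IH) (use All.prems in auto)
  then show ?case by simp
next
  case (Conj p q)
  have "sat M s p = sat M s' p" by (rule Conj.IH(1)) (use Conj.prems in auto)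
  moreover have "sat M s q = sat M s' q" by (rule Conj.IH(2)) (use Conj.prems in auto)
  ultimately show ?case by simp
next
  case (Neg p)
  have "sat M s p = sat M s' p" by (rule Neg.IH) (use Neg.prems in auto)
  then show ?case by simp
qed auto

lemma ex_renaming: "\<exists>q. fv q \<subseteq> f ` fv p \<and> (\<forall>M s. sat M s q \<longleftrightarrow> sat M (\<lambda>i. s (f i)) p)"
proof (induction p arbitrary: f)
  case (Mem i j)
  then show ?case by (intro exI[of _ "Mem (f i) (f j)"]) auto
next
  case (Eq i j)
  then show ?case by (intro exI[of _ "Eq (f i) (f j)"]) auto
next
  case (Neg p)
  then obtain q where "fv q \<subseteq> f ` fv p" "\<forall>M s. sat M s q \<longleftrightarrow> sat M (\<lambda>i. s (f i)) p" by blast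
  then show ?case by (intro exI[of _ "Neg q"]) simp
next
  case (Conj p1 p2)
  obtain q1 where "fv q1 \<subseteq> f ` fv p1" "\<forall>M s. sat M s q1 \<longleftrightarrow> sat M (\<lambda>i. s (f i)) p1"
    using Conj.IH(1) by blast
  moreover obtain q2 where "fv q2 \<subseteq> f ` fv p2" "\<forall>M s. sat M s q2 \<longleftrightarrow> sat M (\<lambda>i. s (f i)) p2"
    using Conj.IH(2) by blast
  ultimately show ?case by (intro exI[of _ "Conj q1 q2"]) auto
next
  case (All n p)
  obtain m where m: "m \<notin> f ` fv p"
    using ex_new_if_finite[of "f ` fv p"] by auto
  obtain q where q: "fv q \<subseteq> f(n := m) ` fv p"
      "\<And>M s. sat M s q \<longleftrightarrow> sat M (\<lambda>i. s ((f(n := m)) i)) p"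
    using All.IH by blast
  have "sat M (s(m := a)) q \<longleftrightarrow> sat M ((\<lambda>i. s (f i))(n := a)) p" for M s a
    unfolding q(2) by (rule sat_cong) (use m in auto)
  then show ?case
    using q(1) by (intro exI[of _ "All m q"]) (auto split: if_splits)
qed

text \<open>The predicate receives \<open>M\<close> so that it can quantify over it. Agreement is
  demanded for transitive \<open>M\<close> only: there the elements of a member are again members,
  so bounded quantifiers can be expressed.\<close>

definition fm_defines :: "fm \<Rightarrow> (hc set \<Rightarrow> (nat \<Rightarrow> hc) \<Rightarrow> bool) \<Rightarrow> bool" where
  "fm_defines p P \<longleftrightarrow>
     (\<forall>M s. transitive_set M \<longrightarrow> range s \<subseteq> M \<longrightarrow> (sat M s p \<longleftrightarrow> P M s))"

definition definable :: "(hc set \<Rightarrow> (nat \<Rightarrow> hc) \<Rightarrow> bool) \<Rightarrow> bool" where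
  "definable P \<longleftrightarrow> (\<exists>p. fm_defines p P)"

lemma fm_definesD:
  "fm_defines p P \<Longrightarrow> transitive_set M \<Longrightarrow> range s \<subseteq> M \<Longrightarrow> sat M s p \<longleftrightarrow> P M s"
  by (simp add: fm_defines_def)

lemma definableI: "fm_defines p P \<Longrightarrow> definable P"
  by (auto simp: definable_def)

lemma definableE: "definable P \<Longrightarrow> (\<And>p. fm_defines p P \<Longrightarrow> thesis) \<Longrightarrow> thesis"
  by (auto simp: definable_def)

lemma definable_cong:
  assumes "definable P"
    and "\<And>M s. transitive_set M \<Longrightarrow> range s \<subseteq> M \<Longrightarrow> P M s \<longleftrightarrow> Q M s"
  shows "definable Q"
proof -
  obtain p where "fm_defines p P" using assms(1) by (rule definableE)
  then have "fm_defines p Q" using assms(2) by (simp add: fm_defines_def)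
  then show ?thesis by (rule definableI)
qed

lemma definable_mem: "definable (\<lambda>M s. s i \<in> elems (s j))"
  by (rule definableI[of "Mem i j"]) (simp add: fm_defines_def)

lemma definable_eq: "definable (\<lambda>M s. s i = s j)"
  by (rule definableI[of "Eq i j"]) (simp add: fm_defines_def)

lemma definable_not:
  assumes "definable P"
  shows "definable (\<lambda>M s. \<not> P M s)"
proof -
  obtain p where "fm_defines p P" using assms by (rule definableE)
  then have "fm_defines (Neg p) (\<lambda>M s. \<not> P M s)" by (simp add: fm_defines_def)
  then show ?thesis by (rule definableI)
qed

lemma definable_conj:
  assumes "definable P" "definable Q"
  shows "definable (\<lambda>M s. P M s \<and> Q M s)"
proof -
  obtain p where "fm_defines p P" using assms(1) by (rule definableE)
  moreover obtain q where "fm_defines q Q" using assms(2) by (rule definableE)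
  ultimately have "fm_defines (Conj p q) (\<lambda>M s. P M s \<and> Q M s)" by (simp add: fm_defines_def)
  then show ?thesis by (rule definableI)
qed

lemma definable_disj:
  assumes "definable P" "definable Q"
  shows "definable (\<lambda>M s. P M s \<or> Q M s)"
  by (rule definable_cong[OF
        definable_not[OF definable_conj[OF assms[THEN definable_not]]]]) blast

lemma definable_imp:
  assumes "definable P" "definable Q"
  shows "definable (\<lambda>M s. P M s \<longrightarrow> Q M s)"
  by (rule definable_cong[OF definable_disj[OF definable_not[OF assms(1)] assms(2)]]) blast

lemma definable_iff:
  assumes "definable P" "definable Q"
  shows "definable (\<lambda>M s. P M s \<longleftrightarrow> Q M s)"
  by (rule definable_cong[OF
        definable_conj[OF definable_imp[OF assms] definable_imp[OF assms(2,1)]]]) blast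

text \<open>This is how the freshness conditions of the schemes are met: \<open>f\<close> is chosen
  to skip the auxiliary variables of the scheme.\<close>

lemma ex_formula_reindexed:
  assumes "definable P"
  shows "\<exists>p. fv p \<subseteq> range f \<and> fm_defines p (\<lambda>M s. P M (\<lambda>i. s (f i)))"
proof -
  obtain p where p: "fm_defines p P" using assms by (rule definableE)
  obtain q where q: "fv q \<subseteq> f ` fv p" "\<forall>M s. sat M s q \<longleftrightarrow> sat M (\<lambda>i. s (f i)) p"
    using ex_renaming by blast
  have "fm_defines q (\<lambda>M s. P M (\<lambda>i. s (f i)))"
    unfolding fm_defines_def
  proof (intro allI impI)
    fix M and s :: "nat \<Rightarrow> hc"
    assume "transitive_set M" "range s \<subseteq> M"
    moreover from this(2) have "range (\<lambda>i. s (f i)) \<subseteq> M" by auto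
    ultimately show "sat M s q \<longleftrightarrow> P M (\<lambda>i. s (f i))"
      using fm_definesD[OF p] q(2) by simp
  qed
  with q(1) show ?thesis by blast
qed

text \<open>
  In the quantifier rules, environments are read as in de Bruijn notation: the bound variable
  becomes index \<open>0\<close> and the other indices are shifted.
\<close>

lemma definable_all:
  assumes "definable (\<lambda>M s. P M (\<lambda>n. s (Suc n)) (s 0))"
  shows "definable (\<lambda>M s. \<forall>a\<in>M. P M s a)"
proof -
  obtain p where p: "fm_defines p (\<lambda>M s. P M (\<lambda>n. s (Suc n)) (s 0))"
    using assms by (rule definableE)
  \<comment> \<open>The formula \<open>q\<close> below is \<open>p\<close> with index
    \<open>0\<close> renamed to \<open>m\<close> and \<open>Suc n\<close> to \<open>n\<close>. Since
    \<open>m\<close> avoids the predecessors of the free variables of \<open>p\<close>, quantifying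
    \<open>m\<close> captures no shifted index.\<close>
  obtain m where m: "m \<notin> (\<lambda>n. n - 1) ` fv p"
    using ex_new_if_finite[of "(\<lambda>n. n - 1) ` fv p"] by auto
  obtain q where q: "\<forall>M s. sat M s q \<longleftrightarrow> sat M (\<lambda>i. s (case_nat m (\<lambda>n. n) i)) p"
    using ex_renaming by blast
  have "sat M (s(m := a)) q \<longleftrightarrow> P M s a"
    if "transitive_set M" "range s \<subseteq> M" "a \<in> M" for M s a
  proof -
    have "sat M (s(m := a)) q \<longleftrightarrow> sat M (case_nat a s) p"
      unfolding q[rule_format] by (rule sat_cong) (use m in \<open>force split: nat.splits\<close>)
    also have "\<dots> \<longleftrightarrow> P M s a"
      using fm_definesD[OF p, of M "case_nat a s"] that
      by (simp add: image_subset_iff split: nat.splits)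
    finally show ?thesis .
  qed
  then have "fm_defines (All m q) (\<lambda>M s. \<forall>a\<in>M. P M s a)"
    by (simp add: fm_defines_def)
  then show ?thesis by (rule definableI)
qed

lemma definable_ex:
  assumes "definable (\<lambda>M s. P M (\<lambda>n. s (Suc n)) (s 0))"
  shows "definable (\<lambda>M s. \<exists>a\<in>M. P M s a)"
proof -
  have "definable (\<lambda>M s. \<not> (\<forall>a\<in>M. \<not> P M s a))"
    by (intro definable_not definable_all assms)
  then show ?thesis by simp
qed

lemma definable_ball:
  assumes "definable (\<lambda>M s. P M (\<lambda>n. s (Suc n)) (s 0))"
  shows "definable (\<lambda>M s. \<forall>a\<in>elems (s i). P M s a)"
proof (rule definable_cong)
  show "definable (\<lambda>M s. \<forall>a\<in>M. a \<in> elems (s i) \<longrightarrow> P M s a)"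
    by (intro definable_all definable_imp definable_mem assms)
next
  fix M and s :: "nat \<Rightarrow> hc"
  assume "transitive_set M" "range s \<subseteq> M"
  then have "elems (s i) \<subseteq> M"
    unfolding transitive_set_def by blast
  then show "(\<forall>a\<in>M. a \<in> elems (s i) \<longrightarrow> P M s a) \<longleftrightarrow> (\<forall>a\<in>elems (s i). P M s a)"
    by blast
qed

lemma definable_bex:
  assumes "definable (\<lambda>M s. P M (\<lambda>n. s (Suc n)) (s 0))"
  shows "definable (\<lambda>M s. \<exists>a\<in>elems (s i). P M s a)"
proof -
  have "definable (\<lambda>M s. \<not> (\<forall>a\<in>elems (s i). \<not> P M s a))"
    by (intro definable_not definable_ball assms)
  then show ?thesis by simp
qed

lemma elems_eq_doubleton_iff:
  "z = hset {x, y} \<longleftrightarrow> x \<in> elems z \<and> y \<in> elems z \<and> (\<forall>u\<in>elems z. u = x \<or> u = y)"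
  by (auto simp: hc_extensionality)

text \<open>Every quantifier on the right is bounded by \<open>z\<close> or by one of its elements.
  The witnesses \<open>u\<close> and \<open>v\<close> are \<open>hset {x}\<close> and
  \<open>hset {x, y}\<close>.\<close>

lemma kpair_eq_iff:
  "z = kpair x y \<longleftrightarrow>
     (\<exists>u\<in>elems z. \<exists>v\<in>elems z. (\<forall>w\<in>elems z. w = u \<or> w = v) \<and>
        (x \<in> elems u \<and> (\<forall>w\<in>elems u. w = x)) \<and>
        (x \<in> elems v \<and> y \<in> elems v \<and> (\<forall>w\<in>elems v. w = x \<or> w = y)))"
    (is "_ \<longleftrightarrow> ?R")
proof
  assume "z = kpair x y"
  then show ?R unfolding kpair_def
    by (intro bexI[of _ "hset {x}"] bexI[of _ "hset {x, y}"]) auto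
next
  assume ?R
  then obtain u v where "u \<in> elems z" "v \<in> elems z" "\<forall>w\<in>elems z. w = u \<or> w = v"
    "u = hset {x, x}" "v = hset {x, y}"
    unfolding elems_eq_doubleton_iff by blast
  moreover from this have "z = hset {u, v}"
    unfolding elems_eq_doubleton_iff by blast
  ultimately show "z = kpair x y"
    by (simp add: kpair_def)
qed

lemma definable_kpair_eq: "definable (\<lambda>M s. s k = kpair (s i) (s j))"
  unfolding kpair_eq_iff
  by (intro definable_bex definable_ball definable_conj definable_disj definable_mem definable_eq)

lemma definable_kpair_mem: "definable (\<lambda>M s. kpair (s i) (s j) \<in> elems (s k))"
proof -
  have "definable (\<lambda>M s. \<exists>z\<in>elems (s k). z = kpair (s i) (s j))"
    by (intro definable_bex definable_kpair_eq)
  then show ?thesis by simp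
qed

lemma transitive_setD: "transitive_set M \<Longrightarrow> x \<in> M \<Longrightarrow> y \<in> elems x \<Longrightarrow> y \<in> M"
  unfolding transitive_set_def by blast

lemma transitive_set_kpairD:
  assumes "transitive_set M" "kpair x y \<in> M"
  shows "x \<in> M" "y \<in> M"
proof -
  have "hset {x, y} \<in> M"
    using assms by (rule transitive_setD) (simp add: kpair_def)
  then show "x \<in> M" "y \<in> M"
    using transitive_setD[OF assms(1)] by force+
qed

text \<open>The inner pair is not a variable and has to be quantified over \<open>M\<close>;
  transitivity puts it there, as a component of an element of \<open>s k\<close>.\<close>

lemma definable_triple_mem: "definable (\<lambda>M s. kpair (s h) (kpair (s i) (s j)) \<in> elems (s k))"
proof (rule definable_cong)
  show "definable (\<lambda>M s. \<exists>z\<in>M. z = kpair (s i) (s j) \<and> kpair (s h) z \<in> elems (s k))"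
    by (intro definable_ex definable_conj definable_kpair_eq definable_kpair_mem)
next
  fix M and s :: "nat \<Rightarrow> hc"
  assume "transitive_set M" "range s \<subseteq> M"
  then show "(\<exists>z\<in>M. z = kpair (s i) (s j) \<and> kpair (s h) z \<in> elems (s k)) \<longleftrightarrow>
      kpair (s h) (kpair (s i) (s j)) \<in> elems (s k)"
    by (metis rangeI subsetD transitive_setD transitive_set_kpairD(2))
qed

lemma definable_triple_eq: "definable (\<lambda>M s. s k = kpair (s h) (kpair (s i) (s j)))"
proof (rule definable_cong)
  show "definable (\<lambda>M s. \<exists>z\<in>M. z = kpair (s i) (s j) \<and> s k = kpair (s h) z)"
    by (intro definable_ex definable_conj definable_kpair_eq)
next
  fix M and s :: "nat \<Rightarrow> hc"
  assume "transitive_set M" "range s \<subseteq> M"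
  then show "(\<exists>z\<in>M. z = kpair (s i) (s j) \<and> s k = kpair (s h) z) \<longleftrightarrow>
      s k = kpair (s h) (kpair (s i) (s j))"
    by (metis rangeI subsetD transitive_set_kpairD(2))
qed

lemmas definable_intros =
  definable_triple_mem definable_triple_eq definable_kpair_mem definable_kpair_eq
  definable_mem definable_eq definable_not definable_conj definable_disj definable_imp
  definable_iff definable_ball definable_bex definable_all definable_ex

section \<open>Closure properties of transitive models\<close>

lemma sat_Imp: "sat M s (Imp p q) \<longleftrightarrow> (sat M s p \<longrightarrow> sat M s q)"
  by simp

lemma sat_Disj: "sat M s (Disj p q) \<longleftrightarrow> sat M s p \<or> sat M s q"
  by simp

lemma sat_Iff: "sat M s (Iff p q) \<longleftrightarrow> (sat M s p \<longleftrightarrow> sat M s q)"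
  by auto

lemma sat_Ex: "sat M s (Ex n p) \<longleftrightarrow> (\<exists>a\<in>M. sat M (s(n := a)) p)"
  by simp

lemmas sat_derived =
  sat_Iff sat_Imp sat_Disj sat_Ex sat.simps(3)[of _ _ "Eq _ _"] sat.simps(4)[of _ _ "Mem _ _"]

definition sep_closed :: "(hc set \<Rightarrow> (nat \<Rightarrow> hc) \<Rightarrow> bool) \<Rightarrow> hc set \<Rightarrow> bool" where
  "sep_closed P M \<longleftrightarrow>
     (\<forall>s x. range s \<subseteq> M \<longrightarrow> x \<in> M \<longrightarrow> hset {z \<in> elems x. P M (case_nat z s)} \<in> M)"

text \<open>Variable \<open>0\<close> is the candidate element. The parameters start at
  \<open>3\<close> because \<open>Separation\<close> uses \<open>1\<close> for the given set and
  \<open>2\<close> for the new one.\<close>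

definition sep_index :: "nat \<Rightarrow> nat" where
  "sep_index = case_nat 0 (\<lambda>i. i + 3)"

text \<open>Choosing one formula for each predicate makes a finite set of predicates yield a finite
  set of axioms.\<close>

definition sep_ax :: "(hc set \<Rightarrow> (nat \<Rightarrow> hc) \<Rightarrow> bool) \<Rightarrow> fm" where
  "sep_ax P = Separation (SOME p. fv p \<subseteq> range sep_index \<and> fm_defines p (\<lambda>M s. P M (\<lambda>i. s (sep_index i))))"

lemma sep_axE:
  assumes "definable P"
  obtains p where "sep_ax P = Separation p" "2 \<notin> fv p"
    "fm_defines p (\<lambda>M s. P M (\<lambda>i. s (sep_index i)))"
proof -
  define p where
    "p = (SOME p. fv p \<subseteq> range sep_index \<and> fm_defines p (\<lambda>M s. P M (\<lambda>i. s (sep_index i))))"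
  have p: "fv p \<subseteq> range sep_index \<and> fm_defines p (\<lambda>M s. P M (\<lambda>i. s (sep_index i)))"
    unfolding p_def by (rule someI_ex[OF ex_formula_reindexed[OF assms]])
  have "2 \<notin> range sep_index"
    by (auto simp: sep_index_def split: nat.splits)
  then have "2 \<notin> fv p"
    using p by blast
  moreover have "sep_ax P = Separation p"
    by (simp add: sep_ax_def p_def)
  ultimately show ?thesis
    using p that by blast
qed

lemma sep_ax_in_ZFC: "definable P \<Longrightarrow> sep_ax P \<in> ZFC"
  by (erule sep_axE) (auto simp: ZFC_def)

lemma sep_closed_if_models:
  assumes "definable P" "transitive_set M" "models M T" "sep_ax P \<in> T"
  shows "sep_closed P M"
  unfolding sep_closed_def
proof (intro allI impI)
  fix s :: "nat \<Rightarrow> hc" and x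
  assume s: "range s \<subseteq> M" and x: "x \<in> M"
  obtain p where p: "sep_ax P = Separation p" "fm_defines p (\<lambda>M s. P M (\<lambda>i. s (sep_index i)))"
    using assms(1) by (rule sep_axE)
  \<comment> \<open>The shift by \<open>3\<close> undoes \<open>sep_index\<close>; the default
    \<open>x\<close> at the indices \<open>0\<close>, \<open>1\<close>, \<open>2\<close> is
    overwritten when the quantifiers of the axiom are evaluated.\<close>
  define t where "t = (\<lambda>i. if i < 3 then x else s (i - 3))"
  have t: "range t \<subseteq> M"
    using s x by (auto simp: t_def)
  then have "sat M t (Separation p)"
    using assms(3,4) p(1) unfolding models_def by metis
  then have "\<exists>y\<in>M. \<forall>z\<in>M. z \<in> elems y \<longleftrightarrow> z \<in> elems x \<and> sat M (t(1 := x, 2 := y, 0 := z)) p"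
    using x by (simp add: Separation_def sat_derived del: sat.simps(3,4))
  then obtain y where y: "y \<in> M"
      "\<And>z. z \<in> M \<Longrightarrow> z \<in> elems y \<longleftrightarrow> z \<in> elems x \<and> sat M (t(1 := x, 2 := y, 0 := z)) p"
    by (elim bexE) simp
  have eq: "sat M (t(1 := x, 2 := y, 0 := z)) p \<longleftrightarrow> P M (case_nat z s)" if "z \<in> M" for z
  proof -
    have "range (t(1 := x, 2 := y, 0 := z)) \<subseteq> M"
      using t that x y(1) by auto
    moreover have "(\<lambda>i. (t(1 := x, 2 := y, 0 := z)) (sep_index i)) = case_nat z s"
      by (auto simp: fun_eq_iff sep_index_def t_def split: nat.splits)
    ultimately show ?thesis
      using fm_definesD[OF p(2) assms(2)] by metis
  qed
  have "z \<in> elems y \<longleftrightarrow> z \<in> elems x \<and> P M (case_nat z s)" for z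
  proof (cases "z \<in> M")
    case True
    then show ?thesis using y(2)[OF True] eq[OF True] by simp
  next
    case False
    then show ?thesis
      using transitive_setD[OF assms(2) y(1)] transitive_setD[OF assms(2) x] by auto
  qed
  then have "elems y = {z \<in> elems x. P M (case_nat z s)}"
    by auto
  then have "y = hset {z \<in> elems x. P M (case_nat z s)}"
    by (metis hset_elems)
  then show "hset {z \<in> elems x. P M (case_nat z s)} \<in> M"
    using y(1) by simp
qed

text \<open>Replacement is applied without parameters: \<open>0\<close> is the argument, and all
  later indices collapse to the value \<open>1\<close>, which keeps \<open>3\<close> and
  \<open>4\<close> fresh.\<close>

definition repl_index :: "nat \<Rightarrow> nat" where
  "repl_index = case_nat 0 (\<lambda>_. 1)"

definition repl_ax :: "(hc set \<Rightarrow> (nat \<Rightarrow> hc) \<Rightarrow> bool) \<Rightarrow> fm" where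
  "repl_ax P =
     Replacement (SOME p. fv p \<subseteq> range repl_index \<and> fm_defines p (\<lambda>M s. P M (\<lambda>i. s (repl_index i))))"

lemma repl_axE:
  assumes "definable P"
  obtains p where "repl_ax P = Replacement p" "3 \<notin> fv p" "4 \<notin> fv p"
    "fm_defines p (\<lambda>M s. P M (\<lambda>i. s (repl_index i)))"
proof -
  define p where
    "p = (SOME p. fv p \<subseteq> range repl_index \<and> fm_defines p (\<lambda>M s. P M (\<lambda>i. s (repl_index i))))"
  have p: "fv p \<subseteq> range repl_index \<and> fm_defines p (\<lambda>M s. P M (\<lambda>i. s (repl_index i)))"
    unfolding p_def by (rule someI_ex[OF ex_formula_reindexed[OF assms]])
  have "3 \<notin> range repl_index" "4 \<notin> range repl_index"
    by (auto simp: repl_index_def split: nat.splits)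
  then have "3 \<notin> fv p" "4 \<notin> fv p"
    using p by blast+
  moreover have "repl_ax P = Replacement p"
    by (simp add: repl_ax_def p_def)
  ultimately show ?thesis
    using p that by blast
qed

lemma repl_ax_in_ZFC: "definable P \<Longrightarrow> repl_ax P \<in> ZFC"
  by (erule repl_axE) (auto simp: ZFC_def)

lemma replacement_if_models:
  assumes "definable P" "transitive_set M" "models M T" "repl_ax P \<in> T"
    and "x \<in> M"
    and unique: "\<And>u. u \<in> elems x \<Longrightarrow> \<exists>v\<in>M. \<forall>y\<in>M. P M (case_nat u (\<lambda>_. y)) \<longrightarrow> y = v"
  obtains y where "y \<in> M" "elems y = {v \<in> M. \<exists>u\<in>elems x. P M (case_nat u (\<lambda>_. v))}"
proof -
  obtain p where p: "repl_ax P = Replacement p" "fm_defines p (\<lambda>M s. P M (\<lambda>i. s (repl_index i)))"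
    using assms(1) by (rule repl_axE)
  have eq: "sat M t p \<longleftrightarrow> P M (case_nat (t 0) (\<lambda>_. t 1))" if "range t \<subseteq> M" for t
  proof -
    have "(\<lambda>i. t (repl_index i)) = case_nat (t 0) (\<lambda>_. t 1)"
      by (auto simp: fun_eq_iff repl_index_def split: nat.splits)
    then show ?thesis
      using fm_definesD[OF p(2) assms(2) that] by metis
  qed
  have xM: "elems x \<subseteq> M"
    using transitive_setD[OF assms(2)] \<open>x \<in> M\<close> by blast
  have "sat M (\<lambda>_. x) (Replacement p)"
    using assms(3,4) p(1) \<open>x \<in> M\<close> unfolding models_def by (metis image_subsetI)
  then have "(\<forall>u\<in>M. u \<in> elems x \<longrightarrow>
        (\<exists>v\<in>M. \<forall>y\<in>M. sat M ((\<lambda>_. x)(2 := x, 0 := u, 4 := v, 1 := y)) p \<longrightarrow> y = v)) \<longrightarrow>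
      (\<exists>y\<in>M. \<forall>v\<in>M. v \<in> elems y \<longleftrightarrow>
        (\<exists>u\<in>M. u \<in> elems x \<and> sat M ((\<lambda>_. x)(2 := x, 3 := y, 1 := v, 0 := u)) p))"
    using \<open>x \<in> M\<close> by (simp add: Replacement_def sat_derived del: sat.simps(3,4))
  moreover have "\<exists>v\<in>M. \<forall>y\<in>M. sat M ((\<lambda>_. x)(2 := x, 0 := u, 4 := v, 1 := y)) p \<longrightarrow> y = v"
    if u: "u \<in> elems x" for u
  proof -
    obtain v where "v \<in> M" "\<forall>y\<in>M. P M (case_nat u (\<lambda>_. y)) \<longrightarrow> y = v"
      using unique[OF u] by (rule bexE)
    moreover have "sat M ((\<lambda>_. x)(2 := x, 0 := u, 4 := v, 1 := y)) p \<longleftrightarrow>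
        P M (case_nat u (\<lambda>_. y))" if "y \<in> M" for y
    proof -
      have "range ((\<lambda>_::nat. x)(2 := x, 0 := u, 4 := v, 1 := y)) \<subseteq> M"
        using \<open>x \<in> M\<close> u xM that \<open>v \<in> M\<close> by auto
      then show ?thesis using eq by simp
    qed
    ultimately show ?thesis by auto
  qed
  ultimately have "\<exists>y\<in>M. \<forall>v\<in>M. v \<in> elems y \<longleftrightarrow>
      (\<exists>u\<in>M. u \<in> elems x \<and> sat M ((\<lambda>_. x)(2 := x, 3 := y, 1 := v, 0 := u)) p)"
    by (elim mp) simp
  then obtain y where y: "y \<in> M" "\<And>v. v \<in> M \<Longrightarrow>
      v \<in> elems y \<longleftrightarrow> (\<exists>u\<in>M. u \<in> elems x \<and> sat M ((\<lambda>_. x)(2 := x, 3 := y, 1 := v, 0 := u)) p)"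
    by (elim bexE) simp
  have "sat M ((\<lambda>_. x)(2 := x, 3 := y, 1 := v, 0 := u)) p \<longleftrightarrow> P M (case_nat u (\<lambda>_. v))"
    if "u \<in> M" "v \<in> M" for u v
  proof -
    have "range ((\<lambda>_::nat. x)(2 := x, 3 := y, 1 := v, 0 := u)) \<subseteq> M"
      using that \<open>x \<in> M\<close> y(1) by auto
    then show ?thesis using eq by simp
  qed
  then have "elems y = {v \<in> M. \<exists>u\<in>elems x. P M (case_nat u (\<lambda>_. v))}"
    using y transitive_setD[OF assms(2)] xM by blast
  with y(1) show ?thesis using that by blast
qed

lemma pairing_if_models:
  assumes "transitive_set M" "models M T" "Pairing \<in> T" "x \<in> M" "y \<in> M"
  shows "hset {x, y} \<in> M"
proof -
  have "sat M (\<lambda>_. x) Pairing"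
    using assms(2-4) unfolding models_def by (metis image_subsetI)
  then have "\<exists>z\<in>M. \<forall>u\<in>M. u \<in> elems z \<longleftrightarrow> u = x \<or> u = y"
    using assms(4,5) by (simp add: Pairing_def sat_derived del: sat.simps(3,4)) metis
  then obtain z where z: "z \<in> M" "\<And>u. u \<in> M \<Longrightarrow> u \<in> elems z \<longleftrightarrow> u = x \<or> u = y"
    by blast
  then have "elems z = {x, y}"
    using transitive_setD[OF assms(1)] assms(4,5) by blast
  then show ?thesis
    using z(1) by (metis hset_elems)
qed

lemma union_if_models:
  assumes "transitive_set M" "models M T" "Union_ax \<in> T" "x \<in> M"
  shows "hset (\<Union> (elems ` elems x)) \<in> M"
proof -
  have "sat M (\<lambda>_. x) Union_ax"
    using assms(2-4) unfolding models_def by (metis image_subsetI)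
  then have "\<exists>z\<in>M. \<forall>u\<in>M. u \<in> elems z \<longleftrightarrow> (\<exists>v\<in>M. v \<in> elems x \<and> u \<in> elems v)"
    using assms(4) by (simp add: Union_ax_def sat_derived del: sat.simps(3,4))
  then obtain z where z: "z \<in> M"
      "\<And>u. u \<in> M \<Longrightarrow> u \<in> elems z \<longleftrightarrow> (\<exists>v\<in>M. v \<in> elems x \<and> u \<in> elems v)"
    by blast
  then have "elems z = \<Union> (elems ` elems x)"
    using transitive_setD[OF assms(1)] assms(4) by blast
  then show ?thesis
    using z(1) by (metis hset_elems)
qed

lemma power_set_if_models:
  assumes "transitive_set M" "models M T" "Power_set \<in> T" "x \<in> M"
  obtains z where "z \<in> M" "elems z = {y \<in> M. elems y \<subseteq> elems x}"
proof -
  have "sat M (\<lambda>_. x) Power_set"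
    using assms(2-4) unfolding models_def by (metis image_subsetI)
  then have "\<exists>z\<in>M. \<forall>u\<in>M. u \<in> elems z \<longleftrightarrow> (\<forall>v\<in>M. v \<in> elems u \<longrightarrow> v \<in> elems x)"
    using assms(4) by (simp add: Power_set_def sat_derived del: sat.simps(3,4))
  then obtain z where z: "z \<in> M"
      "\<And>u. u \<in> M \<Longrightarrow> u \<in> elems z \<longleftrightarrow> (\<forall>v\<in>M. v \<in> elems u \<longrightarrow> v \<in> elems x)"
    by blast
  then have "elems z = {y \<in> M. elems y \<subseteq> elems x}"
    using transitive_setD[OF assms(1)] by blast
  then show ?thesis
    using z(1) that by blast
qed

section \<open>The formulas of the forcing argument and the finite fragment of ZFC\<close>

abbreviation leq :: "hc \<Rightarrow> hc \<Rightarrow> hc \<Rightarrow> bool" where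
  "leq R x y \<equiv> kpair x y \<in> elems R"

text \<open>The set \<open>B\<close> is meant to consist of the nonzero elements, so that the zero
  element does not count as a common lower bound.\<close>

definition incompat :: "hc \<Rightarrow> hc \<Rightarrow> hc \<Rightarrow> hc \<Rightarrow> bool" where
  "incompat B R x y \<longleftrightarrow> (\<forall>e\<in>elems B. leq R e x \<longrightarrow> \<not> leq R e y)"

text \<open>An order-theoretic form of the identity between the meets of \<open>d\<close> with
  \<open>u\<close> and with \<open>v\<close>.\<close>

definition agree :: "hc \<Rightarrow> hc \<Rightarrow> hc \<Rightarrow> hc \<Rightarrow> hc \<Rightarrow> bool" where
  "agree B R d u v \<longleftrightarrow> (\<forall>e\<in>elems B. leq R e d \<longrightarrow> (leq R e u \<longleftrightarrow> leq R e v))"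

text \<open>
  \<open>F\<close> codes a forcing relation: \<open>kpair w (kpair a p) \<in> elems F\<close> says that \<open>p\<close> forces the name \<open>w\<close> to
  denote the ground model set \<open>a\<close>. Comparing names with ground model sets, not with other names,
  makes check names unnecessary.
\<close>

definition elem_at :: "hc \<Rightarrow> hc \<Rightarrow> hc \<Rightarrow> hc \<Rightarrow> bool" where
  "elem_at F w a s \<longleftrightarrow> (\<exists>b\<in>elems a. kpair w (kpair b s) \<in> elems F)"

text \<open>This is an explicit witness that \<open>s\<close> puts \<open>b\<close> into the value
  of \<open>w\<close>. Forced membership is density of such witnesses below a condition.\<close>

definition val_at :: "hc \<Rightarrow> hc \<Rightarrow> hc \<Rightarrow> hc \<Rightarrow> hc \<Rightarrow> hc \<Rightarrow> hc \<Rightarrow> bool" where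
  "val_at Y A R F w b s \<longleftrightarrow>
     (\<exists>u\<in>elems Y. \<exists>p\<in>elems A. kpair u p \<in> elems w \<and> leq R s p \<and> kpair u (kpair b s) \<in> elems F)"

text \<open>The two clauses are the two inclusions between the value of \<open>w\<close> and
  \<open>a\<close>, each expressed as density of witnesses. Only the entries of \<open>F\<close> at
  names occurring in \<open>w\<close> are consulted, so this is one step of a recursion on
  names.\<close>

definition force_eq :: "hc \<Rightarrow> hc \<Rightarrow> hc \<Rightarrow> hc \<Rightarrow> hc \<Rightarrow> hc \<Rightarrow> hc \<Rightarrow> hc \<Rightarrow> bool" where
  "force_eq Y A B R F w a p \<longleftrightarrow>
     (\<forall>u\<in>elems Y. \<forall>q\<in>elems A. kpair u q \<in> elems w \<longrightarrow>
        (\<forall>r\<in>elems B. leq R r p \<and> leq R r q \<longrightarrow> (\<exists>s\<in>elems B. leq R s r \<and> elem_at F u a s))) \<and>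
     (\<forall>b\<in>elems a. \<forall>r\<in>elems B. leq R r p \<longrightarrow>
        (\<exists>s\<in>elems B. leq R s r \<and> val_at Y A R F w b s))"

text \<open>A partial solution of the recursion. Its domain \<open>C\<close> is closed under the
  names occurring in its members, while \<open>Y\<close> bounds both the names and the sets they may
  denote.\<close>

definition forcing_on :: "hc \<Rightarrow> hc \<Rightarrow> hc \<Rightarrow> hc \<Rightarrow> hc \<Rightarrow> hc \<Rightarrow> bool" where
  "forcing_on Y A B R C F \<longleftrightarrow>
     (\<forall>w\<in>elems C. w \<in> elems Y) \<and>
     (\<forall>w\<in>elems C. \<forall>u\<in>elems Y. \<forall>p\<in>elems A. kpair u p \<in> elems w \<longrightarrow> u \<in> elems C) \<and>
     (\<forall>w\<in>elems C. \<forall>a\<in>elems Y. \<forall>p\<in>elems B.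
        kpair w (kpair a p) \<in> elems F \<longleftrightarrow> force_eq Y A B R F w a p)"

text \<open>The last two cases are the two ways in which \<open>force_eq\<close> can fail below a
  condition, which is why deciding conditions are dense.\<close>

definition decided :: "hc \<Rightarrow> hc \<Rightarrow> hc \<Rightarrow> hc \<Rightarrow> hc \<Rightarrow> hc \<Rightarrow> hc \<Rightarrow> hc \<Rightarrow> bool" where
  "decided Y A B R F w a d \<longleftrightarrow>
     kpair w (kpair a d) \<in> elems F \<or>
     (\<exists>u\<in>elems Y. \<exists>q\<in>elems A. kpair u q \<in> elems w \<and> leq R d q \<and>
        (\<forall>s\<in>elems B. leq R s d \<longrightarrow> \<not> elem_at F u a s)) \<or>
     (\<exists>b\<in>elems a. \<forall>s\<in>elems B. leq R s d \<longrightarrow> \<not> val_at Y A R F w b s)"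

text \<open>
  Only meaningful for names \<open>t\<close> of \<open>A\<close> itself: a pair \<open>(w, p)\<close> in \<open>t\<close> together with a condition
  forcing \<open>w\<close> to denote \<open>a\<close> serves as a substitute for the check name of \<open>a\<close>.
\<close>

definition generic_name :: "hc \<Rightarrow> hc \<Rightarrow> hc \<Rightarrow> hc \<Rightarrow> hc \<Rightarrow> hc \<Rightarrow> hc \<Rightarrow> bool" where
  "generic_name Y A B R F t z \<longleftrightarrow>
     (\<exists>w\<in>elems Y. \<exists>s\<in>elems B. z = kpair w s \<and>
        (\<exists>p\<in>elems A. kpair w p \<in> elems t \<and> leq R s p) \<and>
        (\<exists>a\<in>elems A. leq R s a \<and> kpair w (kpair a s) \<in> elems F))"

text \<open>The graph of the map sending \<open>a\<close> to the Boolean value of the statement that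
  \<open>a\<close> belongs to \<open>t\<close>, the supremum being expressed by the order
  alone.\<close>

definition bool_value :: "hc \<Rightarrow> hc \<Rightarrow> hc \<Rightarrow> hc \<Rightarrow> hc \<Rightarrow> hc \<Rightarrow> hc \<Rightarrow> bool" where
  "bool_value Y A B R F t z \<longleftrightarrow>
     (\<exists>a\<in>elems A. \<exists>b\<in>elems A. z = kpair a b \<and>
        (\<forall>s\<in>elems B. val_at Y A R F t a s \<longrightarrow> leq R s b) \<and>
        (\<forall>c\<in>elems A. (\<forall>s\<in>elems B. val_at Y A R F t a s \<longrightarrow> leq R s c) \<longrightarrow> leq R b c))"

definition agree_decided :: "hc \<Rightarrow> hc \<Rightarrow> hc \<Rightarrow> hc \<Rightarrow> hc \<Rightarrow> bool" where
  "agree_decided A B R P d \<longleftrightarrow>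
     (\<forall>u\<in>elems A. \<forall>v\<in>elems A. kpair u v \<in> elems P \<longrightarrow> agree B R d u v) \<or>
     (\<exists>u\<in>elems A. \<exists>v\<in>elems A. kpair u v \<in> elems P \<and>
        (leq R d u \<and> incompat B R d v \<or> leq R d v \<and> incompat B R d u))"

definition is_meet :: "hc \<Rightarrow> hc \<Rightarrow> hc \<Rightarrow> hc \<Rightarrow> hc \<Rightarrow> bool" where
  "is_meet A R m a b \<longleftrightarrow> (\<forall>e\<in>elems A. leq R e m \<longleftrightarrow> leq R e a \<and> leq R e b)"

text \<open>
  The pairs that a generic filter \<open>G\<close> cannot separate if the preimage of \<open>G\<close> under \<open>f\<close> is a
  filter whose preimage under \<open>g\<close> is \<open>G\<close>.
\<close>

definition unseparated :: "hc \<Rightarrow> hc \<Rightarrow> hc \<Rightarrow> hc \<Rightarrow> hc \<Rightarrow> bool" where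
  "unseparated A R f g z \<longleftrightarrow>
     (\<exists>u\<in>elems A. \<exists>v\<in>elems A. z = kpair u v \<and>
        ((\<exists>c\<in>elems A. kpair v c \<in> elems g \<and> kpair c u \<in> elems f) \<or>
         (\<exists>a\<in>elems A. \<exists>b\<in>elems A. \<exists>m\<in>elems A. \<exists>x\<in>elems A. \<exists>y\<in>elems A.
            is_meet A R m a b \<and> kpair m u \<in> elems f \<and>
            kpair a x \<in> elems f \<and> kpair b y \<in> elems f \<and> is_meet A R v x y)))"

text \<open>The graph of the involution, described without joins: when \<open>p\<close>,
  \<open>q\<close>, \<open>r\<close> partition the unit, agreement on each of the three parts
  determines \<open>c\<close>.\<close>

definition swap_rel :: "hc \<Rightarrow> hc \<Rightarrow> hc \<Rightarrow> hc \<Rightarrow> hc \<Rightarrow> hc \<Rightarrow> hc \<Rightarrow> hc \<Rightarrow> hc \<Rightarrow> bool" where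
  "swap_rel A B R f g p q r z \<longleftrightarrow>
     (\<exists>b\<in>elems A. \<exists>c\<in>elems A. z = kpair b c \<and>
        (\<exists>x\<in>elems A. kpair b x \<in> elems f \<and> agree B R p c x) \<and>
        (\<exists>y\<in>elems A. kpair b y \<in> elems g \<and> agree B R q c y) \<and>
        agree B R r c b)"

text \<open>The transitive closure of \<open>{u}\<close> as it is seen in \<open>M\<close>.\<close>

definition least_trans :: "hc set \<Rightarrow> hc \<Rightarrow> hc \<Rightarrow> bool" where
  "least_trans M u y \<longleftrightarrow>
     (\<forall>a\<in>elems y. \<forall>b\<in>elems a. b \<in> elems y) \<and> u \<in> elems y \<and>
     (\<forall>z\<in>M. (\<forall>a\<in>elems z. \<forall>b\<in>elems a. b \<in> elems z) \<and> u \<in> elems z \<longrightarrow>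
        (\<forall>a\<in>elems y. a \<in> elems z))"

definition least_trans_pred :: "hc set \<Rightarrow> (nat \<Rightarrow> hc) \<Rightarrow> bool" where
  "least_trans_pred M s \<longleftrightarrow> least_trans M (s 0) (s 1)"

lemma definable_least_trans_pred: "definable least_trans_pred"
proof -
  have "definable (\<lambda>M s. least_trans M (s 0) (s 1))"
    unfolding least_trans_def by (intro definable_intros)
  then show ?thesis
    by (rule definable_cong) (simp add: least_trans_pred_def)
qed

text \<open>The complete list of predicates for which Separation is used. Index \<open>0\<close> is
  the element tested; the other indices are parameters, in the order of the lists passed to
  \<open>separation\<close> and \<open>separationI\<close>.\<close>

definition sep_preds :: "(hc set \<Rightarrow> (nat \<Rightarrow> hc) \<Rightarrow> bool) set" where
  "sep_preds =
    {\<lambda>M s. s 0 \<noteq> s 1,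
     \<lambda>M s. \<exists>x\<in>elems (s 1). \<exists>y\<in>elems (s 2). s 0 = kpair x y,
     \<lambda>M s. \<exists>C\<in>M. \<exists>K\<in>M. forcing_on (s 1) (s 2) (s 3) (s 4) C K \<and> s 0 \<in> elems C,
     \<lambda>M s. \<exists>C\<in>M. \<exists>K\<in>M. forcing_on (s 1) (s 2) (s 3) (s 4) C K \<and> s 0 \<in> elems K \<and>
             (\<exists>w\<in>elems C. \<exists>a\<in>elems (s 1). \<exists>p\<in>elems (s 3). s 0 = kpair w (kpair a p)),
     \<lambda>M s. s 0 \<in> elems (s 5) \<and>
             (\<exists>w\<in>elems (s 6). \<exists>a\<in>elems (s 1). \<exists>p\<in>elems (s 3). s 0 = kpair w (kpair a p)) \<or>
           (\<exists>a\<in>elems (s 1). \<exists>p\<in>elems (s 3). s 0 = kpair (s 7) (kpair a p) \<and>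
             force_eq (s 1) (s 2) (s 3) (s 4) (s 5) (s 7) a p),
     \<lambda>M s. s 0 \<in> elems (s 3) \<or> incompat (s 1) (s 2) (s 0) (s 4),
     \<lambda>M s. elem_at (s 1) (s 2) (s 3) (s 0),
     \<lambda>M s. val_at (s 1) (s 2) (s 3) (s 4) (s 5) (s 6) (s 0),
     \<lambda>M s. decided (s 1) (s 2) (s 3) (s 4) (s 5) (s 6) (s 7) (s 0),
     \<lambda>M s. generic_name (s 1) (s 2) (s 3) (s 4) (s 5) (s 6) (s 0),
     \<lambda>M s. bool_value (s 1) (s 2) (s 3) (s 4) (s 5) (s 6) (s 0),
     \<lambda>M s. \<exists>x\<in>elems (s 2). leq (s 1) (s 0) x,
     \<lambda>M s. agree_decided (s 1) (s 2) (s 3) (s 4) (s 0),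
     \<lambda>M s. unseparated (s 1) (s 2) (s 3) (s 4) (s 0),
     \<lambda>M s. swap_rel (s 1) (s 2) (s 3) (s 4) (s 5) (s 6) (s 7) (s 8) (s 0)}"

lemmas pred_defs = forcing_on_def force_eq_def incompat_def elem_at_def val_at_def decided_def
  generic_name_def bool_value_def agree_decided_def agree_def unseparated_def is_meet_def
  swap_rel_def

lemma definable_sep_preds:
  assumes "P \<in> sep_preds"
  shows "definable P"
proof -
  have "Ball sep_preds definable"
    unfolding sep_preds_def ball_simps pred_defs
    by (intro conjI definable_intros TrueI)
  with assms show ?thesis by blast
qed

definition base_axioms :: "fm set" where
  "base_axioms =
     {Pairing, Union_ax, Power_set, repl_ax least_trans_pred} \<union> sep_ax ` sep_preds"

lemma finite_base_axioms: "finite base_axioms"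
  by (simp add: base_axioms_def sep_preds_def)

lemma base_axioms_subset_ZFC: "base_axioms \<subseteq> ZFC"
proof -
  have "sep_ax ` sep_preds \<subseteq> ZFC"
    using sep_ax_in_ZFC definable_sep_preds by blast
  moreover have "repl_ax least_trans_pred \<in> ZFC"
    using repl_ax_in_ZFC definable_least_trans_pred by blast
  ultimately show ?thesis
    by (auto simp: base_axioms_def ZFC_def)
qed

text \<open>The default value has to lie in every model considered; for the empty set this is
  \<open>empty_closed\<close>.\<close>

primrec env :: "hc list \<Rightarrow> nat \<Rightarrow> hc" where
  "env [] = (\<lambda>_. hset {})"
| "env (x # xs) = case_nat x (env xs)"

text \<open>Countability is left to \<open>ground_model\<close>, because the models intersected in
  \<open>adjoin\<close> are not assumed to be countable and the argument about finite modifications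
  has to run in each of them.\<close>

locale base_model =
  fixes M :: "hc set"
  assumes transitive: "transitive_set M"
    and models_base: "models M base_axioms"
begin

lemma elem_closed: "x \<in> M \<Longrightarrow> y \<in> elems x \<Longrightarrow> y \<in> M"
  using transitive by (rule transitive_setD)

text \<open>Descend from any member of \<open>M\<close>: a nonempty set in the transitive
  \<open>M\<close> has an element in \<open>M\<close>, and foundation stops the descent.\<close>

lemma empty_closed: "hset {} \<in> M"
proof -
  obtain x where "x \<in> M"
    using models_base unfolding models_def by blast
  then show ?thesis
  proof (induction x rule: hc_mem_induct)
    case (1 x)
    then show ?case
      by (metis elem_closed equals0I hset_elems)
  qed
qed

lemma env_in_M: "set xs \<subseteq> M \<Longrightarrow> range (env xs) \<subseteq> M"
  by (induction xs) (auto simp: empty_closed image_subset_iff split: nat.splits)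

lemma separation:
  assumes "P \<in> sep_preds" "x \<in> M" "set xs \<subseteq> M"
  shows "hset {z \<in> elems x. P M (case_nat z (env xs))} \<in> M"
proof -
  have "sep_closed P M"
    using assms(1) definable_sep_preds transitive models_base
    by (intro sep_closed_if_models[of P M base_axioms]) (auto simp: base_axioms_def)
  then show ?thesis
    using assms(2,3) env_in_M unfolding sep_closed_def by blast
qed

lemma pair_closed: "x \<in> M \<Longrightarrow> y \<in> M \<Longrightarrow> hset {x, y} \<in> M"
  by (rule pairing_if_models[OF transitive models_base]) (auto simp: base_axioms_def)

lemma kpair_closed: "x \<in> M \<Longrightarrow> y \<in> M \<Longrightarrow> kpair x y \<in> M"
  using pair_closed[of x x] pair_closed[of x y] by (simp add: kpair_def pair_closed)

lemma Union_closed: "x \<in> M \<Longrightarrow> hset (\<Union> (elems ` elems x)) \<in> M"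
  by (rule union_if_models[OF transitive models_base]) (auto simp: base_axioms_def)

lemma Un_closed:
  assumes "x \<in> M" "y \<in> M"
  shows "hset (elems x \<union> elems y) \<in> M"
  using Union_closed[OF pair_closed[OF assms]] by simp

lemma insert_closed:
  assumes "x \<in> M" "y \<in> M"
  shows "hset (insert x (elems y)) \<in> M"
  using Un_closed[OF pair_closed[OF assms(1,1)] assms(2)] by simp

lemma remove_closed:
  assumes "x \<in> M" "y \<in> M"
  shows "hset (elems y - {x}) \<in> M"
proof -
  have "hset {z \<in> elems y. z \<noteq> x} \<in> M"
    using separation[of "\<lambda>M s. s 0 \<noteq> s 1" y "[x]"] assms
    by (simp add: sep_preds_def)
  then show ?thesis
    by (simp add: set_diff_eq)
qed

end

definition hc_prod :: "hc \<Rightarrow> hc \<Rightarrow> hc" where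
  "hc_prod x y = hset ((\<lambda>(a, b). kpair a b) ` (elems x \<times> elems y))"

lemma elems_hc_prod: "elems (hc_prod x y) = (\<lambda>(a, b). kpair a b) ` (elems x \<times> elems y)"
  by (simp add: hc_prod_def)

lemma kpair_in_hc_prod [simp]: "kpair a b \<in> elems (hc_prod x y) \<longleftrightarrow> a \<in> elems x \<and> b \<in> elems y"
  by (force simp: elems_hc_prod)

locale ground_model = base_model +
  assumes countable_M: "countable M"
begin

lemma separationI:
  assumes "P \<in> sep_preds" "x \<in> M" "set xs \<subseteq> M"
    and "\<And>z. z \<in> elems x \<Longrightarrow> P M (case_nat z (env xs)) \<longleftrightarrow> Q z"
  shows "hset {z \<in> elems x. Q z} \<in> M"
proof -
  have "{z \<in> elems x. P M (case_nat z (env xs))} = {z \<in> elems x. Q z}"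
    using assms(4) by auto
  then show ?thesis
    using separation[OF assms(1-3)] by simp
qed

text \<open>
  \<open>least_trans\<close> makes the transitive set unique, as Replacement requires.
\<close>

lemma ex_transitive_superset:
  assumes "x \<in> M"
  obtains y where "y \<in> M" "x \<in> elems y" "transitive_set (elems y)"
proof -
  have "\<exists>y\<in>M. least_trans M x y"
    using assms
  proof (induction x rule: hc_mem_induct)
    case (1 x)
    have IH: "\<exists>y\<in>M. least_trans M u y" if "u \<in> elems x" for u
      using 1 that elem_closed by blast
    have uniq: "y = y'" if "least_trans M u y" "least_trans M u y'" "y \<in> M" "y' \<in> M" for u y y'
      using that unfolding least_trans_def hc_extensionality by blast
    have unique: "\<exists>v\<in>M. \<forall>y\<in>M. least_trans_pred M (case_nat u (\<lambda>_. y)) \<longrightarrow> y = v"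
      if "u \<in> elems x" for u
      using IH[OF that] uniq by (auto simp: least_trans_pred_def)
    have ax: "repl_ax least_trans_pred \<in> base_axioms"
      by (simp add: base_axioms_def)
    obtain Z where Z: "Z \<in> M"
      "elems Z = {v \<in> M. \<exists>u\<in>elems x. least_trans_pred M (case_nat u (\<lambda>_. v))}"
      by (rule replacement_if_models[OF definable_least_trans_pred transitive models_base ax
            \<open>x \<in> M\<close> unique])
    \<comment> \<open>The elements of \<open>Z\<close> are the transitive closures for the elements
      of \<open>x\<close>, so adding \<open>x\<close> to their union gives the one for
      \<open>x\<close>.\<close>
    define y where "y = hset (insert x (elems (hset (\<Union> (elems ` elems Z)))))"
    have yM: "y \<in> M"
      unfolding y_def using insert_closed Union_closed Z(1) \<open>x \<in> M\<close> by blast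
    have y: "a \<in> elems y \<longleftrightarrow> a = x \<or> (\<exists>v\<in>M. \<exists>u\<in>elems x. least_trans M u v \<and> a \<in> elems v)"
      for a
    proof -
      have "countable (\<Union> (elems ` elems Z))" by auto
      then have "elems y = insert x (\<Union> (elems ` elems Z))"
        by (simp add: y_def)
      then show ?thesis by (auto simp: Z(2) least_trans_pred_def)
    qed
    have "least_trans M x y"
      unfolding least_trans_def
    proof (intro conjI ballI impI)
      show "x \<in> elems y" using y by blast
    next
      fix a b assume "a \<in> elems y" "b \<in> elems a"
      with y[THEN iffD1, OF this(1)] consider "b \<in> elems x" | v u where "v \<in> M" "u \<in> elems x" "least_trans M u v" "a \<in> elems v"
        by auto
      then show "b \<in> elems y"
      proof cases
        case 1
        then obtain v where "v \<in> M" "least_trans M b v" using IH by blast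
        moreover from this(2) have "b \<in> elems v" unfolding least_trans_def by blast
        ultimately show ?thesis using y 1 by blast
      next
        case 2
        then have "b \<in> elems v" using \<open>b \<in> elems a\<close> unfolding least_trans_def by blast
        then show ?thesis using y 2 by blast
      qed
    next
      fix z a
      assume z: "z \<in> M" "(\<forall>a\<in>elems z. \<forall>b\<in>elems a. b \<in> elems z) \<and> x \<in> elems z"
        and a: "a \<in> elems y"
      from y[THEN iffD1, OF a] consider "a = x" | v u where "v \<in> M" "u \<in> elems x" "least_trans M u v" "a \<in> elems v"
        by auto
      then show "a \<in> elems z"
      proof cases
        case 2
        moreover have "u \<in> elems z" using z(2) 2(2) by blast
        ultimately show ?thesis using z unfolding least_trans_def by blast
      qed (use z in simp)
    qed
    with yM show ?case by blast
  qed
  then show ?thesis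
    using that unfolding least_trans_def transitive_set_def by blast
qed

lemma ex_power: "x \<in> M \<Longrightarrow> \<exists>z\<in>M. elems z = {y \<in> M. elems y \<subseteq> elems x}"
  by (rule power_set_if_models[OF transitive models_base, of x]) (auto simp: base_axioms_def)

text \<open>Pairs of elements of \<open>u\<close> lie in the second power set of \<open>u\<close>
  formed in \<open>M\<close>, and Separation cuts the product out of it.\<close>

lemma hc_prod_closed:
  assumes "x \<in> M" "y \<in> M"
  shows "hc_prod x y \<in> M"
proof -
  define u where "u = hset (elems x \<union> elems y)"
  have u: "u \<in> M" "elems u = elems x \<union> elems y"
    using Un_closed[OF assms] by (simp_all add: u_def)
  obtain v where v: "v \<in> M" "elems v = {w \<in> M. elems w \<subseteq> elems u}"
    using ex_power[OF u(1)] by blast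
  obtain w where w: "w \<in> M" "elems w = {z \<in> M. elems z \<subseteq> elems v}"
    using ex_power[OF v(1)] by blast
  have "kpair a b \<in> elems w" if "a \<in> elems x" "b \<in> elems y" for a b
  proof -
    have ab: "a \<in> M" "b \<in> M"
      using that assms elem_closed by blast+
    have "hset {a} \<in> elems v"
      using pair_closed[OF ab(1,1)] that by (simp add: v(2) u(2))
    moreover have "hset {a, b} \<in> elems v"
      using pair_closed[OF ab] that by (simp add: v(2) u(2))
    ultimately show ?thesis
      using kpair_closed[OF ab] by (simp add: w(2) kpair_def)
  qed
  then have "elems (hc_prod x y) = {z \<in> elems w. \<exists>a\<in>elems x. \<exists>b\<in>elems y. z = kpair a b}"
    by (auto simp: elems_hc_prod)
  then have "hc_prod x y = hset {z \<in> elems w. \<exists>a\<in>elems x. \<exists>b\<in>elems y. z = kpair a b}"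
    by (metis hset_elems)
  moreover have "hset {z \<in> elems w. \<exists>a\<in>elems x. \<exists>b\<in>elems y. z = kpair a b} \<in> M"
    by (rule separationI[of "\<lambda>M s. \<exists>x\<in>elems (s 1). \<exists>y\<in>elems (s 2). s 0 = kpair x y" _ "[x, y]"])
      (use assms w(1) in \<open>simp_all add: sep_preds_def numeral_eq_Suc\<close>)
  ultimately show ?thesis by simp
qed

end

section \<open>Generic filters on a complete Boolean algebra\<close>

locale forcing = ground_model +
  fixes A R :: hc
  assumes algebra_in_M: "kpair A R \<in> M"
    and complete: "complete_boolean_algebra_in M A R"
begin

abbreviation L :: "hc gorder" where "L \<equiv> ord_of A R"

definition zero :: hc where "zero = \<bottom>\<^bsub>L\<^esub>"

definition B :: hc where "B = hset (elems A - {zero})"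

definition meet :: "hc \<Rightarrow> hc \<Rightarrow> hc" where "meet x y = x \<sqinter>\<^bsub>L\<^esub> y"

lemma A_closed: "A \<in> M" and R_closed: "R \<in> M"
  using transitive_set_kpairD[OF transitive algebra_in_M] by auto

lemma elems_B: "elems B = elems A - {zero}"
  by (simp add: B_def)

lemma B_closed: "B \<in> M"
proof -
  have "zero \<in> M \<or> zero \<notin> elems A"
    using A_closed elem_closed by blast
  then show ?thesis
    using A_closed remove_closed[of zero A] by (auto simp: B_def)
qed

lemma boolean: "boolean_algebra_on A R"
  using complete by (simp add: complete_boolean_algebra_in_def)

lemma bounded: "bounded_lattice L"
  using boolean by (simp add: boolean_algebra_on_def Let_def)

sublocale lat: bounded_lattice L
  by (rule bounded)

lemma L_simps [simp]: "carrier L = elems A" "x \<sqsubseteq>\<^bsub>L\<^esub> y \<longleftrightarrow> leq R x y"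
  by (simp_all add: ord_of_def)

lemma leq_carrier: "leq R x y \<Longrightarrow> x \<in> elems A \<and> y \<in> elems A"
  using boolean unfolding boolean_algebra_on_def by fastforce

lemma leq_refl: "x \<in> elems A \<Longrightarrow> leq R x x"
  using lat.le_refl[of x] by simp

lemma leq_trans: "leq R x y \<Longrightarrow> leq R y z \<Longrightarrow> leq R x z"
  using lat.le_trans[of x y z] leq_carrier by auto

lemma leq_antisym: "leq R x y \<Longrightarrow> leq R y x \<Longrightarrow> x = y"
  using lat.le_antisym[of x y] leq_carrier by auto

lemma zero_leq: "x \<in> elems A \<Longrightarrow> leq R zero x"
  using lat.bottom_lower[of x] by (simp add: zero_def)

lemma meet_in: "x \<in> elems A \<Longrightarrow> y \<in> elems A \<Longrightarrow> meet x y \<in> elems A"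
  using lat.meet_closed[of x y] by (simp add: meet_def)

lemma leq_meet_iff:
  assumes "x \<in> elems A" "y \<in> elems A"
  shows "leq R e (meet x y) \<longleftrightarrow> leq R e x \<and> leq R e y"
proof
  assume "leq R e (meet x y)"
  moreover have "leq R (meet x y) x" "leq R (meet x y) y"
    using lat.meet_left[of x y] lat.meet_right[of x y] assms by (simp_all add: meet_def)
  ultimately show "leq R e x \<and> leq R e y"
    using leq_trans by blast
next
  assume "leq R e x \<and> leq R e y"
  then show "leq R e (meet x y)"
    using lat.meet_le[of e x y] leq_carrier[of e x] assms by (simp add: meet_def)
qed

lemma B_iff: "e \<in> elems B \<longleftrightarrow> e \<in> elems A \<and> e \<noteq> zero"
  by (simp add: elems_B)

lemma incompat_iff:
  assumes "x \<in> elems A" "y \<in> elems A"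
  shows "incompat B R x y \<longleftrightarrow> meet x y = zero"
proof
  assume "incompat B R x y"
  moreover have "leq R (meet x y) x" "leq R (meet x y) y"
    using leq_meet_iff[OF assms] leq_refl meet_in[OF assms] by blast+
  ultimately show "meet x y = zero"
    using meet_in[OF assms] B_iff unfolding incompat_def by blast
next
  assume zero: "meet x y = zero"
  have "e = zero" if "leq R e x" "leq R e y" for e
  proof (rule leq_antisym)
    show "leq R e zero" using leq_meet_iff[OF assms] that zero by simp
    show "leq R zero e" using leq_carrier that zero_leq by blast
  qed
  then show "incompat B R x y"
    using B_iff unfolding incompat_def by blast
qed

text \<open>Distributivity splits each \<open>d\<close> into its meets with \<open>x\<close> and
  with the complement \<open>c\<close>; if one part vanishes, \<open>d\<close> lies below the other
  factor.\<close>

lemma complement_exists: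
  assumes "x \<in> elems A"
  obtains c where "c \<in> elems A" "incompat B R x c"
    "\<And>d. d \<in> elems A \<Longrightarrow> incompat B R d x \<Longrightarrow> leq R d c"
    "\<And>d. d \<in> elems A \<Longrightarrow> incompat B R d c \<Longrightarrow> leq R d x"
proof -
  obtain c where c: "c \<in> elems A" "x \<sqinter>\<^bsub>L\<^esub> c = \<bottom>\<^bsub>L\<^esub>" "x \<squnion>\<^bsub>L\<^esub> c = \<top>\<^bsub>L\<^esub>"
    using boolean assms by (force simp: boolean_algebra_on_def Let_def)
  have split: "d = meet d x \<squnion>\<^bsub>L\<^esub> meet d c" if d: "d \<in> elems A" for d
  proof -
    have "d \<sqinter>\<^bsub>L\<^esub> (x \<squnion>\<^bsub>L\<^esub> c) = meet d x \<squnion>\<^bsub>L\<^esub> meet d c"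
      using boolean assms c(1) d by (simp add: boolean_algebra_on_def Let_def meet_def)
    moreover have "d \<sqinter>\<^bsub>L\<^esub> (x \<squnion>\<^bsub>L\<^esub> c) = d"
      using lat.top_meet[of d] d by (simp add: c(3) meet_comm[of L d "\<top>\<^bsub>L\<^esub>"] lat.eq_is_equal)
    ultimately show ?thesis by simp
  qed
  have join_zero: "zero \<squnion>\<^bsub>L\<^esub> y = y" if "y \<in> elems A" for y
    using lat.bottom_join[of y] that by (simp add: zero_def lat.eq_is_equal)
  show ?thesis
  proof
    show "c \<in> elems A" by fact
    show "incompat B R x c"
      using c assms by (simp add: incompat_iff meet_def zero_def)
  next
    fix d assume d: "d \<in> elems A" "incompat B R d x"
    then have "d = meet d c"
      using split[OF d(1)] join_zero[OF meet_in[OF d(1) c(1)]] assms by (simp add: incompat_iff)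
    then show "leq R d c"
      using leq_meet_iff[OF d(1) c(1)] leq_refl d(1) by metis
  next
    fix d assume d: "d \<in> elems A" "incompat B R d c"
    then have "d = meet d x"
      using split[OF d(1)] join_zero[OF meet_in[OF d(1) assms]] c(1)
      by (simp add: incompat_iff join_comm[of L _ zero])
    then show "leq R d x"
      using leq_meet_iff[OF d(1) assms] leq_refl d(1) by metis
  qed
qed

text \<open>Separativity of a Boolean algebra: the witness is the meet of \<open>x\<close> with the
  complement of \<open>y\<close>.\<close>

lemma not_leqE:
  assumes "x \<in> elems A" "y \<in> elems A" "\<not> leq R x y"
  obtains d where "d \<in> elems B" "leq R d x" "incompat B R d y"
proof -
  obtain c where c: "c \<in> elems A" "incompat B R y c"
    "\<And>d. d \<in> elems A \<Longrightarrow> incompat B R d c \<Longrightarrow> leq R d y"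
    using complement_exists[OF assms(2)] by metis
  have "meet x c \<noteq> zero"
    using c assms incompat_iff by blast
  then have "meet x c \<in> elems B"
    using meet_in[OF assms(1) c(1)] B_iff by blast
  moreover have "leq R (meet x c) x" "leq R (meet x c) c"
    using leq_meet_iff[OF assms(1) c(1)] leq_refl meet_in[OF assms(1) c(1)] by blast+
  moreover have "incompat B R (meet x c) y"
    using c(2) \<open>leq R (meet x c) c\<close> leq_trans unfolding incompat_def by blast
  ultimately show ?thesis using that by blast
qed

section \<open>Generic filters and density\<close>

definition is_generic :: "hc set \<Rightarrow> bool" where
  "is_generic F \<longleftrightarrow> generic M A R F"

lemma generic_facts:
  assumes "is_generic F"
  shows "F \<subseteq> elems A" "zero \<notin> F"
    and "\<And>x y. x \<in> F \<Longrightarrow> y \<in> F \<Longrightarrow> meet x y \<in> F"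
    and "\<And>x y. x \<in> F \<Longrightarrow> leq R x y \<Longrightarrow> y \<in> F"
  using assms leq_carrier
  by (auto simp: is_generic_def generic_def filter_on_def Let_def zero_def meet_def)

lemma generic_subset_B: "is_generic F \<Longrightarrow> x \<in> F \<Longrightarrow> x \<in> elems B"
  using generic_facts(1,2) B_iff by blast

lemma generic_common_lower:
  assumes "is_generic F" "x \<in> F" "y \<in> F"
  obtains z where "z \<in> F" "z \<in> elems B" "leq R z x" "leq R z y"
proof
  have xy: "x \<in> elems A" "y \<in> elems A"
    using assms generic_facts(1) by blast+
  show "meet x y \<in> F" using generic_facts(3) assms by blast
  then show "meet x y \<in> elems B" using generic_subset_B assms by blast
  show "leq R (meet x y) x" "leq R (meet x y) y"
    using leq_meet_iff[OF xy] leq_refl meet_in[OF xy] by blast+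
qed

lemma generic_not_incompat:
  "is_generic F \<Longrightarrow> x \<in> F \<Longrightarrow> y \<in> F \<Longrightarrow> \<not> incompat B R x y"
  by (metis generic_common_lower incompat_def)

lemma generic_meets_dense:
  assumes "is_generic F" "D \<in> M" "elems D \<subseteq> elems B"
    and "\<And>x. x \<in> elems B \<Longrightarrow> \<exists>d\<in>elems D. leq R d x"
  obtains d where "d \<in> elems D" "d \<in> F"
proof -
  have "dense_in A R (elems D)"
    using assms(3,4) unfolding dense_in_def Let_def by (simp add: elems_B zero_def)
  then have "elems D \<inter> F \<noteq> {}"
    using assms(1,2) unfolding is_generic_def generic_def by blast
  then show ?thesis using that by blast
qed

text \<open>A set dense below \<open>p\<close> becomes dense once the conditions incompatible with
  \<open>p\<close> are added. The disjunction allows for filters that omit \<open>p\<close>, as in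
  \<open>complementE\<close>.\<close>

lemma generic_dense_below_or_incompat:
  assumes "is_generic F" "p \<in> elems A" "E \<in> M" "elems E \<subseteq> elems B"
    and "\<And>r. r \<in> elems B \<Longrightarrow> leq R r p \<Longrightarrow> \<exists>s\<in>elems E. leq R s r"
  obtains d where "d \<in> F" "d \<in> elems E \<or> incompat B R d p"
proof -
  define D where "D = hset {d \<in> elems B. d \<in> elems E \<or> incompat B R d p}"
  have "D \<in> M"
    unfolding D_def
    by (rule separationI[of "\<lambda>M s. s 0 \<in> elems (s 3) \<or> incompat (s 1) (s 2) (s 0) (s 4)" _
          "[B, R, E, p]"])
      (use assms A_closed B_closed R_closed elem_closed in \<open>simp_all add: sep_preds_def numeral_eq_Suc\<close>)
  moreover have D: "elems D = {d \<in> elems B. d \<in> elems E \<or> incompat B R d p}"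
    unfolding D_def by (rule elems_hset) (rule countable_subset[OF _ countable_elems[of B]], blast)
  moreover have "\<exists>d\<in>elems D. leq R d x" if x: "x \<in> elems B" for x
  proof (cases "incompat B R x p")
    case True
    then show ?thesis using x D leq_refl B_iff by blast
  next
    case False
    then obtain e where "e \<in> elems B" "leq R e x" "leq R e p"
      unfolding incompat_def by blast
    with assms(5) obtain s where "s \<in> elems E" "leq R s e" by blast
    then show ?thesis
      using assms(4) D \<open>leq R e x\<close> leq_trans by blast
  qed
  ultimately obtain d where "d \<in> elems D" "d \<in> F"
    using generic_meets_dense[OF assms(1), of D] by blast
  then show ?thesis using that D by blast
qed

lemma generic_dense_below:
  assumes "is_generic F" "p \<in> F" "E \<in> M" "elems E \<subseteq> elems B"
    and "\<And>r. r \<in> elems B \<Longrightarrow> leq R r p \<Longrightarrow> \<exists>s\<in>elems E. leq R s r"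
  obtains d where "d \<in> F" "d \<in> elems E"
proof -
  have "p \<in> elems A" using assms generic_facts(1) by blast
  then obtain d where "d \<in> F" "d \<in> elems E \<or> incompat B R d p"
    using generic_dense_below_or_incompat assms by metis
  then show ?thesis
    using that generic_not_incompat assms(1,2) by blast
qed

lemma downset_closed:
  assumes "X \<in> M"
  shows "hset {d \<in> elems B. \<exists>x\<in>elems X. leq R d x} \<in> M"
  by (rule separationI[of "\<lambda>M s. \<exists>x\<in>elems (s 2). leq (s 1) (s 0) x" _ "[R, X]"])
    (use assms B_closed R_closed in \<open>simp_all add: sep_preds_def numeral_eq_Suc\<close>)

lemma elems_downset: "elems (hset {d \<in> elems B. Q d}) = {d \<in> elems B. Q d}"
  by (rule elems_hset) (rule countable_subset[OF _ countable_elems[of B]], blast)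

definition is_lub :: "hc \<Rightarrow> hc set \<Rightarrow> bool" where
  "is_lub b X \<longleftrightarrow> b \<in> elems A \<and> (\<forall>x\<in>X. leq R x b) \<and>
     (\<forall>c\<in>elems A. (\<forall>x\<in>X. leq R x c) \<longrightarrow> leq R b c)"

lemma lub_exists:
  assumes "X \<in> M" "elems X \<subseteq> elems A"
  obtains b where "is_lub b (elems X)"
proof -
  obtain b where "least L b (Upper L (elems X))"
    using complete assms unfolding complete_boolean_algebra_in_def by blast
  then have "is_lub b (elems X)"
    using assms(2) by (auto simp: is_lub_def least_def Upper_def)
  then show ?thesis using that by blast
qed

text \<open>The conditions below members of \<open>X\<close> are dense below the supremum
  \<open>b\<close>: a condition \<open>r\<close> below \<open>b\<close> without such an extension is
  disjoint from all of \<open>X\<close>, so the complement of \<open>r\<close> is an upper bound and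
  \<open>b\<close>, hence \<open>r\<close>, lies below it.\<close>

lemma generic_lub_iff:
  assumes "is_generic F" "X \<in> M" "elems X \<subseteq> elems A" "is_lub b (elems X)"
  shows "b \<in> F \<longleftrightarrow> (\<exists>x\<in>elems X. x \<in> F)"
proof
  assume "b \<in> F"
  define E where "E = hset {d \<in> elems B. \<exists>x\<in>elems X. leq R d x}"
  have E: "E \<in> M" "elems E = {d \<in> elems B. \<exists>x\<in>elems X. leq R d x}"
    unfolding E_def by (rule downset_closed[OF assms(2)], rule elems_downset)
  have "\<exists>s\<in>elems E. leq R s r" if r: "r \<in> elems B" "leq R r b" for r
  proof (rule ccontr)
    assume none: "\<not> (\<exists>s\<in>elems E. leq R s r)"
    have rA: "r \<in> elems A" using r B_iff by blast
    obtain c where c: "c \<in> elems A" "incompat B R r c"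
      "\<And>d. d \<in> elems A \<Longrightarrow> incompat B R d r \<Longrightarrow> leq R d c"
      using complement_exists[OF rA] by metis
    have "incompat B R x r" if "x \<in> elems X" for x
      using none that E(2) unfolding incompat_def by blast
    then have "leq R b c"
      using c(1,3) assms(3,4) unfolding is_lub_def by blast
    then show False
      using c(2) r leq_trans leq_refl rA unfolding incompat_def by blast
  qed
  then obtain d where "d \<in> F" "d \<in> elems E"
    using generic_dense_below[OF assms(1) \<open>b \<in> F\<close> E(1)] E(2) by blast
  then show "\<exists>x\<in>elems X. x \<in> F"
    using E(2) generic_facts(4)[OF assms(1)] by blast
next
  assume "\<exists>x\<in>elems X. x \<in> F"
  then show "b \<in> F"
    using assms(4) generic_facts(4)[OF assms(1)] unfolding is_lub_def by blast
qed

lemma rasiowa_sikorski: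
  assumes "p \<in> elems B"
  obtains F where "is_generic F" "p \<in> F"
proof -
  define e where "e = from_nat_into M"
  have e: "range e = M"
    unfolding e_def using countable_M empty_closed by (intro range_from_nat_into) auto
  \<comment> \<open>The enumeration runs through all of \<open>M\<close>; at a stage whose set is
    not dense, the only demand is to stay below the previous condition.\<close>
  define Q where "Q n q d \<longleftrightarrow> d \<in> elems B \<and> leq R d q \<and>
    (dense_in A R (elems (e n)) \<longrightarrow> d \<in> elems (e n))" for n q d
  have Q: "\<exists>d. Q n q d" if "q \<in> elems B" for n q
  proof (cases "dense_in A R (elems (e n))")
    case True
    then have "\<exists>d\<in>elems (e n). d \<in> elems B \<and> leq R d q"
      using that unfolding dense_in_def Let_def L_simps elems_B zero_def by blast
    then show ?thesis using True by (auto simp: Q_def)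
  next
    case False
    then show ?thesis using that leq_refl B_iff by (auto simp: Q_def)
  qed
  define q where "q = rec_nat p (\<lambda>n x. SOME d. Q n x d)"
  have q: "q n \<in> elems B \<and> Q n (q n) (q (Suc n))" for n
  proof (induction n)
    case 0
    show ?case using someI_ex[OF Q[OF assms]] assms by (simp add: q_def)
  next
    case (Suc n)
    then have "q (Suc n) \<in> elems B" by (simp add: Q_def)
    then show ?case using someI_ex[OF Q] by (simp add: q_def)
  qed
  have mono: "leq R (q (n + k)) (q n)" for n k
  proof (induction k)
    case 0
    show ?case using q[of n] leq_refl B_iff by simp
  next
    case (Suc k)
    have "leq R (q (Suc (n + k))) (q (n + k))"
      using q[of "n + k"] by (simp add: Q_def)
    with Suc show ?case using leq_trans by simp
  qed
  define F where "F = {x. \<exists>n. leq R (q n) x}"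
  have in_F: "q n \<in> F" for n
    using mono[of n 0] unfolding F_def by auto
  have "p \<in> F" using in_F[of 0] by (simp add: q_def)
  have "\<top>\<^bsub>L\<^esub> \<in> F"
    using lat.top_higher[of p] \<open>p \<in> F\<close> leq_trans assms B_iff unfolding F_def by auto
  moreover have "zero \<notin> F"
  proof
    assume "zero \<in> F"
    then obtain n where "leq R (q n) zero" unfolding F_def by blast
    moreover have "q n \<in> elems A" "q n \<noteq> zero" using q[of n] B_iff by auto
    ultimately show False using leq_antisym zero_leq by blast
  qed
  moreover have "meet x y \<in> F" if xy: "x \<in> F" "y \<in> F" for x y
  proof -
    obtain m n where mn: "leq R (q m) x" "leq R (q n) y" using xy unfolding F_def by blast
    then have "leq R (q (m + n)) x" "leq R (q (m + n)) y"
      using leq_trans[OF mono[of m n] mn(1)] leq_trans[OF mono[of n m] mn(2)]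
      by (simp_all add: add.commute)
    then have "leq R (q (m + n)) (meet x y)"
      using leq_meet_iff leq_carrier by blast
    then show ?thesis unfolding F_def by blast
  qed
  moreover have "y \<in> F" if "x \<in> F" "leq R x y" for x y
    using that leq_trans unfolding F_def by blast
  moreover have "F \<subseteq> elems A"
    using leq_carrier unfolding F_def by blast
  ultimately have "filter_on A R F"
    unfolding filter_on_def Let_def zero_def meet_def by simp
  moreover have "elems D \<inter> F \<noteq> {}" if D: "D \<in> M" "dense_in A R (elems D)" for D
  proof -
    obtain n where "e n = D" using D(1) e by blast
    then have "q (Suc n) \<in> elems D" using q[of n] D(2) by (simp add: Q_def)
    then show ?thesis using in_F by blast
  qed
  ultimately have "is_generic F"
    unfolding is_generic_def generic_def by blast
  then show ?thesis using that \<open>p \<in> F\<close> by blast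
qed

text \<open>
  A Stone representation: it turns Boolean identities into identities of sets.
\<close>

definition S :: "hc \<Rightarrow> hc set set" where
  "S a = {F. is_generic F \<and> a \<in> F}"

text \<open>If \<open>a\<close> is not below \<open>b\<close>, a nonzero condition below
  \<open>a\<close> and disjoint from \<open>b\<close> extends to a generic filter that contains
  \<open>a\<close> but not \<open>b\<close>.\<close>

lemma S_leq_iff:
  assumes "a \<in> elems A" "b \<in> elems A"
  shows "leq R a b \<longleftrightarrow> S a \<subseteq> S b"
proof
  assume "leq R a b"
  then show "S a \<subseteq> S b" using generic_facts(4) unfolding S_def by blast
next
  assume sub: "S a \<subseteq> S b"
  show "leq R a b"
  proof (rule ccontr)
    assume "\<not> leq R a b"
    then obtain d where d: "d \<in> elems B" "leq R d a" "incompat B R d b"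
      using not_leqE[OF assms] by blast
    obtain F where "is_generic F" "d \<in> F" using rasiowa_sikorski[OF d(1)] by blast
    then have "b \<in> F" using sub d(2) generic_facts(4) unfolding S_def by blast
    then show False using generic_not_incompat \<open>is_generic F\<close> \<open>d \<in> F\<close> d(3) by blast
  qed
qed

lemma S_inject: "a \<in> elems A \<Longrightarrow> b \<in> elems A \<Longrightarrow> S a = S b \<longleftrightarrow> a = b"
  using S_leq_iff[of a b] S_leq_iff[of b a] leq_antisym[of a b] by auto

lemma S_meet:
  assumes "a \<in> elems A" "b \<in> elems A"
  shows "S (meet a b) = S a \<inter> S b"
proof -
  have "leq R (meet a b) a" "leq R (meet a b) b"
    using leq_meet_iff[OF assms] leq_refl meet_in[OF assms] by blast+
  then show ?thesis
    using generic_facts(3,4) unfolding S_def by blast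
qed

text \<open>Generic filters are ultrafilters: the conditions below \<open>a\<close> and those
  incompatible with \<open>a\<close> together form a dense set in \<open>M\<close>.\<close>

lemma complementE:
  assumes "a \<in> elems A"
  obtains c where "c \<in> elems A" "S c = Collect is_generic - S a"
proof -
  obtain c where c: "c \<in> elems A" "incompat B R a c"
      "\<And>d. d \<in> elems A \<Longrightarrow> incompat B R d a \<Longrightarrow> leq R d c"
    using complement_exists[OF assms] by metis
  have "c \<in> F" if F: "is_generic F" "a \<notin> F" for F
  proof -
    define E where "E = hset {d \<in> elems B. \<exists>x\<in>elems (hset {a}). leq R d x}"
    have "hset {a} \<in> M" using pair_closed[of a a] assms A_closed elem_closed by auto
    then have E: "E \<in> M" "elems E = {d \<in> elems B. leq R d a}"
      unfolding E_def using downset_closed[of "hset {a}"] by (simp_all add: elems_downset)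
    have "\<exists>s\<in>elems E. leq R s r" if "r \<in> elems B" "leq R r a" for r
      using that E(2) leq_refl B_iff by blast
    then obtain d where "d \<in> F" "d \<in> elems E \<or> incompat B R d a"
      using generic_dense_below_or_incompat[OF F(1) assms E(1)] E(2) by blast
    moreover from this have "d \<in> elems A" "d \<notin> elems E"
      using F generic_facts(1,4)[OF F(1)] E(2) by blast+
    ultimately show ?thesis
      using c(3) generic_facts(4)[OF F(1)] by blast
  qed
  moreover have "\<not> (c \<in> F \<and> a \<in> F)" if "is_generic F" for F
    using generic_not_incompat[OF that] c(2) by blast
  ultimately have "S c = Collect is_generic - S a"
    unfolding S_def by blast
  then show ?thesis using that c(1) by blast
qed

lemma joinE:
  assumes "a \<in> elems A" "b \<in> elems A"
  obtains c where "c \<in> elems A" "S c = S a \<union> S b"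
proof -
  obtain a' where a': "a' \<in> elems A" "S a' = Collect is_generic - S a"
    using complementE[OF assms(1)] .
  obtain b' where b': "b' \<in> elems A" "S b' = Collect is_generic - S b"
    using complementE[OF assms(2)] .
  obtain c where c: "c \<in> elems A" "S c = Collect is_generic - S (meet a' b')"
    using complementE[OF meet_in[OF a'(1) b'(1)]] .
  have "S c = S a \<union> S b"
    unfolding c(2) S_meet[OF a'(1) b'(1)] a'(2) b'(2) by (auto simp: S_def)
  then show ?thesis using that c(1) by blast
qed

lemma agree_iff:
  assumes "d \<in> elems A" "u \<in> elems A" "v \<in> elems A"
  shows "agree B R d u v \<longleftrightarrow> S d \<inter> S u = S d \<inter> S v"
proof
  assume agree: "agree B R d u v"
  have "v' \<in> F" if F: "is_generic F" "d \<in> F" "u' \<in> F"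
    and uv: "\<And>e. e \<in> elems B \<Longrightarrow> leq R e d \<Longrightarrow> leq R e u' \<Longrightarrow> leq R e v'" for F u' v'
  proof -
    obtain z where "z \<in> F" "z \<in> elems B" "leq R z d" "leq R z u'"
      using generic_common_lower[OF F] .
    then show ?thesis using uv generic_facts(4)[OF F(1)] by blast
  qed
  then show "S d \<inter> S u = S d \<inter> S v"
    using agree unfolding agree_def S_def by blast
next
  assume "S d \<inter> S u = S d \<inter> S v"
  show "agree B R d u v"
    unfolding agree_def
  proof (intro ballI impI)
    fix e assume "e \<in> elems B" "leq R e d"
    then have "e \<in> elems A" "S e \<subseteq> S d"
      using S_leq_iff assms(1) B_iff by auto
    then show "leq R e u \<longleftrightarrow> leq R e v"
      using S_leq_iff assms(2,3) \<open>S d \<inter> S u = S d \<inter> S v\<close> by auto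
  qed
qed

lemma is_meet_iff:
  assumes "m \<in> elems A" "a \<in> elems A" "b \<in> elems A"
  shows "is_meet A R m a b \<longleftrightarrow> m = meet a b"
  unfolding is_meet_def using leq_meet_iff[OF assms(2,3)] leq_refl leq_antisym meet_in assms
  by metis

text \<open>One condition handles all pairs of \<open>P\<close> at once. Where agreement fails for a
  pair, some smaller condition lies below one member and is disjoint from the other, so the
  conditions satisfying \<open>agree_decided\<close> are dense. A condition in \<open>F\<close>
  cannot separate a pair that \<open>F\<close> does not separate, so it must make all pairs
  agree.\<close>

lemma generic_agree:
  assumes F: "is_generic F" and P: "P \<in> M"
    and same: "\<And>u v. u \<in> elems A \<Longrightarrow> v \<in> elems A \<Longrightarrow> kpair u v \<in> elems P \<Longrightarrow> u \<in> F \<longleftrightarrow> v \<in> F"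
  obtains p where "p \<in> F"
    "\<And>u v. u \<in> elems A \<Longrightarrow> v \<in> elems A \<Longrightarrow> kpair u v \<in> elems P \<Longrightarrow> S p \<inter> S u = S p \<inter> S v"
proof -
  define D where "D = hset {d \<in> elems B. agree_decided A B R P d}"
  have "D \<in> M"
    unfolding D_def
    by (rule separationI[of "\<lambda>M s. agree_decided (s 1) (s 2) (s 3) (s 4) (s 0)" _ "[A, B, R, P]"])
      (use P A_closed B_closed R_closed in \<open>simp_all add: sep_preds_def numeral_eq_Suc\<close>)
  moreover have D: "elems D = {d \<in> elems B. agree_decided A B R P d}"
    unfolding D_def by (rule elems_downset)
  moreover have "\<exists>d\<in>elems D. leq R d x" if x: "x \<in> elems B" for x
  proof (cases "agree_decided A B R P x")
    case True
    then show ?thesis using x D leq_refl B_iff by blast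
  next
    case False
    then obtain u v e where uv: "u \<in> elems A" "v \<in> elems A" "kpair u v \<in> elems P"
      and e: "e \<in> elems B" "leq R e x" "leq R e u \<noteq> leq R e v"
      unfolding agree_decided_def agree_def by blast
    have "\<exists>d\<in>elems B. leq R d e \<and> (leq R d u \<and> incompat B R d v \<or> leq R d v \<and> incompat B R d u)"
    proof (cases "leq R e u")
      case True
      then obtain d where "d \<in> elems B" "leq R d e" "incompat B R d v"
        using e uv not_leqE B_iff by metis
      then show ?thesis using True leq_trans by blast
    next
      case False
      then obtain d where "d \<in> elems B" "leq R d e" "incompat B R d u"
        using e uv not_leqE B_iff by metis
      then show ?thesis using False e(3) leq_trans by blast
    qed
    then show ?thesis
      using D uv e(2) leq_trans unfolding agree_decided_def by blast
  qed
  ultimately obtain p where p: "p \<in> elems D" "p \<in> F"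
    using generic_meets_dense[OF F, of D] by blast
  have "\<not> (leq R p u \<and> incompat B R p v \<or> leq R p v \<and> incompat B R p u)"
    if "u \<in> elems A" "v \<in> elems A" "kpair u v \<in> elems P" for u v
    using same[OF that] p(2) generic_not_incompat[OF F] generic_facts(4)[OF F] by blast
  then have "agree B R p u v" if "u \<in> elems A" "v \<in> elems A" "kpair u v \<in> elems P" for u v
    using p(1) D that unfolding agree_decided_def by blast
  moreover have "p \<in> elems A"
    using p(2) generic_facts(1)[OF F] by blast
  ultimately have "S p \<inter> S u = S p \<inter> S v"
    if "u \<in> elems A" "v \<in> elems A" "kpair u v \<in> elems P" for u v
    using that by (simp add: agree_iff)
  then show ?thesis using that p(2) by blast
qed

end

section \<open>The forcing relation\<close>

lemma hc_mem_induct_kpair: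
  assumes "\<And>w. (\<And>u q. kpair u q \<in> elems w \<Longrightarrow> P u) \<Longrightarrow> P w"
  shows "P w"
proof (induction rule: wf_induct[OF wf_trancl[OF wf_mem_rel]])
  case (1 w)
  show ?case
  proof (rule assms)
    fix u q assume "kpair u q \<in> elems w"
    then have "(kpair u q, w) \<in> mem_rel" by (simp add: mem_rel_def)
    then have "(u, w) \<in> mem_rel\<^sup>+"
      using kpair_mem_trancl[of u q] by (rule trancl_into_trancl[rotated])
    then show "P u" using 1 by blast
  qed
qed

lemma force_eq_cong:
  assumes "\<And>u q a p. u \<in> elems Y \<Longrightarrow> q \<in> elems A \<Longrightarrow> kpair u q \<in> elems w \<Longrightarrow> a \<in> elems Y \<Longrightarrow>
      p \<in> elems B \<Longrightarrow> kpair u (kpair a p) \<in> elems F \<longleftrightarrow> kpair u (kpair a p) \<in> elems F'"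
    and "elems a \<subseteq> elems Y"
  shows "force_eq Y A B R F w a p \<longleftrightarrow> force_eq Y A B R F' w a p"
proof -
  have "elem_at F u a s \<longleftrightarrow> elem_at F' u a s"
    if "u \<in> elems Y" "q \<in> elems A" "kpair u q \<in> elems w" "s \<in> elems B" for u q s
    using assms that unfolding elem_at_def by blast
  moreover have "val_at Y A R F w b s \<longleftrightarrow> val_at Y A R F' w b s"
    if "b \<in> elems a" "s \<in> elems B" for b s
    using assms that unfolding val_at_def by blast
  ultimately show ?thesis
    unfolding force_eq_def by blast
qed

text \<open>Both domains are closed under the names occurring in their members, so induction on
  names never leaves their intersection. This makes the union of all partial solutions
  coherent.\<close>

lemma forcing_on_unique:
  assumes "forcing_on Y A B R C F" "forcing_on Y A B R C' F'"
    and "transitive_set (elems Y)"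
    and "w \<in> elems C" "w \<in> elems C'" "a \<in> elems Y" "p \<in> elems B"
  shows "kpair w (kpair a p) \<in> elems F \<longleftrightarrow> kpair w (kpair a p) \<in> elems F'"
  using assms(4-7)
proof (induction w arbitrary: a p rule: hc_mem_induct_kpair)
  case (1 w)
  have "force_eq Y A B R F w a p \<longleftrightarrow> force_eq Y A B R F' w a p"
  proof (rule force_eq_cong)
    show "elems a \<subseteq> elems Y"
      using assms(3) 1 unfolding transitive_set_def by blast
    fix u q b r
    assume *: "u \<in> elems Y" "q \<in> elems A" "kpair u q \<in> elems w" "b \<in> elems Y" "r \<in> elems B"
    then have "u \<in> elems C" "u \<in> elems C'"
      using assms(1,2) 1 unfolding forcing_on_def by blast+
    then show "kpair u (kpair b r) \<in> elems F \<longleftrightarrow> kpair u (kpair b r) \<in> elems F'"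
      using 1 * by blast
  qed
  then show ?case
    using assms(1,2) 1 unfolding forcing_on_def by blast
qed

context forcing
begin

text \<open>
  Recursion on names without Replacement: the union of all partial forcing relations is in \<open>M\<close> by
  Separation, and every name belongs to the domain of one of them.
\<close>

lemma ex_forcing_relation:
  assumes Y: "Y \<in> M" "transitive_set (elems Y)"
  obtains F where "F \<in> M" "forcing_on Y A B R Y F"
proof -
  have params: "A \<in> M" "B \<in> M" "R \<in> M"
    by (fact A_closed B_closed R_closed)+
  define good where "good C K \<longleftrightarrow> C \<in> M \<and> K \<in> M \<and> forcing_on Y A B R C K" for C K
  \<comment> \<open>The set \<open>D\<close> is the union of the domains of all partial solutions,
    and \<open>F\<close> below is the union of the solutions themselves, each restricted to its
    domain.\<close>
  define D where "D = hset {w \<in> elems Y. \<exists>C\<in>M. \<exists>K\<in>M. forcing_on Y A B R C K \<and> w \<in> elems C}"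
  have DM: "D \<in> M"
    unfolding D_def
    by (rule separationI[of "\<lambda>M s. \<exists>C\<in>M. \<exists>K\<in>M. forcing_on (s 1) (s 2) (s 3) (s 4) C K \<and>
            s 0 \<in> elems C" _ "[Y, A, B, R]"])
      (use params Y in \<open>simp_all add: sep_preds_def numeral_eq_Suc\<close>)
  have D: "w \<in> elems D \<longleftrightarrow> w \<in> elems Y \<and> (\<exists>C K. good C K \<and> w \<in> elems C)" for w
    unfolding D_def good_def by (subst elems_hset) auto
  define T where "T = hc_prod Y (hc_prod Y B)"
  have TM: "T \<in> M"
    unfolding T_def by (intro hc_prod_closed params Y)
  define F where "F = hset {z \<in> elems T. \<exists>C\<in>M. \<exists>K\<in>M. forcing_on Y A B R C K \<and> z \<in> elems K \<and>
      (\<exists>w\<in>elems C. \<exists>a\<in>elems Y. \<exists>p\<in>elems B. z = kpair w (kpair a p))}"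
  have FM: "F \<in> M"
    unfolding F_def
    by (rule separationI[of "\<lambda>M s. \<exists>C\<in>M. \<exists>K\<in>M. forcing_on (s 1) (s 2) (s 3) (s 4) C K \<and>
             s 0 \<in> elems K \<and>
             (\<exists>w\<in>elems C. \<exists>a\<in>elems (s 1). \<exists>p\<in>elems (s 3). s 0 = kpair w (kpair a p))" _
            "[Y, A, B, R]"])
      (use params Y TM in \<open>simp_all add: sep_preds_def numeral_eq_Suc\<close>)
  have F: "kpair w (kpair a p) \<in> elems F \<longleftrightarrow> kpair w (kpair a p) \<in> elems K"
    if "good C K" "w \<in> elems C" "a \<in> elems Y" "p \<in> elems B" for C K w a p
  proof -
    have "kpair w (kpair a p) \<in> elems F \<longleftrightarrow>
        kpair w (kpair a p) \<in> elems T \<and>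
        (\<exists>C K. good C K \<and> w \<in> elems C \<and> kpair w (kpair a p) \<in> elems K)"
      unfolding F_def good_def using that(3,4) by (subst elems_hset) auto
    moreover have "w \<in> elems Y"
      using that(1,2) unfolding good_def forcing_on_def by blast
    moreover have "kpair w (kpair a p) \<in> elems K' \<longleftrightarrow> kpair w (kpair a p) \<in> elems K"
      if "good C' K'" "w \<in> elems C'" for C' K'
      using forcing_on_unique[of Y A B R C' K' C K w a p] that \<open>good C K\<close> \<open>w \<in> elems C\<close>
        \<open>a \<in> elems Y\<close> \<open>p \<in> elems B\<close> Y(2) by (simp add: good_def)
    then have "(\<exists>C K. good C K \<and> w \<in> elems C \<and> kpair w (kpair a p) \<in> elems K) \<longleftrightarrow>
        kpair w (kpair a p) \<in> elems K"
      using that(1,2) by metis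
    ultimately show ?thesis
      using that(3,4) by (simp add: T_def)
  qed
  have D_down: "u \<in> elems D"
    if w: "w \<in> elems D" and u: "u \<in> elems Y" "q \<in> elems A" "kpair u q \<in> elems w" for w u q
  proof -
    obtain C K where CK: "good C K" "w \<in> elems C"
      using D[THEN iffD1, OF w] by (elim conjE exE)
    then have "u \<in> elems C" using u unfolding good_def forcing_on_def by blast
    then show ?thesis using u(1) CK(1) by (intro D[THEN iffD2] conjI exI)
  qed
  have F_step: "kpair w (kpair a p) \<in> elems F \<longleftrightarrow> force_eq Y A B R F w a p"
    if w: "w \<in> elems D" and ap: "a \<in> elems Y" "p \<in> elems B" for w a p
  proof -
    obtain C K where CK: "good C K" "w \<in> elems C" using w D by blast
    have "force_eq Y A B R F w a p \<longleftrightarrow> force_eq Y A B R K w a p"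
    proof (rule force_eq_cong)
      show "elems a \<subseteq> elems Y"
        using Y(2) ap(1) unfolding transitive_set_def by blast
      fix u q b r
      assume *: "u \<in> elems Y" "q \<in> elems A" "kpair u q \<in> elems w" "b \<in> elems Y" "r \<in> elems B"
      then have "u \<in> elems C"
        using CK unfolding good_def forcing_on_def by blast
      then show "kpair u (kpair b r) \<in> elems F \<longleftrightarrow> kpair u (kpair b r) \<in> elems K"
        using F[OF CK(1)] * by blast
    qed
    moreover have "kpair w (kpair a p) \<in> elems K \<longleftrightarrow> force_eq Y A B R K w a p"
      using CK ap unfolding good_def forcing_on_def by blast
    ultimately show ?thesis
      using F[OF CK ap] by blast
  qed
  have "w \<in> elems D" if "w \<in> elems Y" for w
    using that
  proof (induction w rule: hc_mem_induct_kpair)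
    case (1 w)
    \<comment> \<open>Extend \<open>F\<close> by the single name \<open>w\<close>. The names
      occurring in \<open>w\<close> are in \<open>D\<close> by the induction hypothesis, so
      \<open>force_eq\<close> over \<open>F\<close> already determines the new entries; if
      \<open>w\<close> is in \<open>D\<close>, they coincide with the old ones.\<close>
    define K where "K = hset {z \<in> elems T. z \<in> elems F \<and>
         (\<exists>w\<in>elems D. \<exists>a\<in>elems Y. \<exists>p\<in>elems B. z = kpair w (kpair a p)) \<or>
       (\<exists>a\<in>elems Y. \<exists>p\<in>elems B. z = kpair w (kpair a p) \<and> force_eq Y A B R F w a p)}"
    have KM: "K \<in> M"
      unfolding K_def
      by (rule separationI[of "\<lambda>M s. s 0 \<in> elems (s 5) \<and>
             (\<exists>w\<in>elems (s 6). \<exists>a\<in>elems (s 1). \<exists>p\<in>elems (s 3). s 0 = kpair w (kpair a p)) \<or>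
           (\<exists>a\<in>elems (s 1). \<exists>p\<in>elems (s 3). s 0 = kpair (s 7) (kpair a p) \<and>
             force_eq (s 1) (s 2) (s 3) (s 4) (s 5) (s 7) a p)" _ "[Y, A, B, R, F, D, w]"])
        (use params Y TM FM DM 1 elem_closed in \<open>simp_all add: sep_preds_def numeral_eq_Suc\<close>)
    have K: "kpair v (kpair a p) \<in> elems K \<longleftrightarrow>
        v \<in> elems Y \<and> (kpair v (kpair a p) \<in> elems F \<and> v \<in> elems D \<or>
          v = w \<and> force_eq Y A B R F w a p)" if "a \<in> elems Y" "p \<in> elems B" for v a p
      unfolding K_def using that by (subst elems_hset) (auto simp: T_def)
    have K_D: "kpair v (kpair a p) \<in> elems K \<longleftrightarrow> kpair v (kpair a p) \<in> elems F"
      if "v \<in> elems D" "a \<in> elems Y" "p \<in> elems B" for v a p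
      using K[OF that(2,3)] F_step that D by blast
    define C where "C = hset (insert w (elems D))"
    have C: "C \<in> M" "elems C = insert w (elems D)"
      using insert_closed[OF _ DM] 1 Y elem_closed unfolding C_def by auto
    have preds: "u \<in> elems D"
      if "v \<in> elems C" "u \<in> elems Y" "q \<in> elems A" "kpair u q \<in> elems v" for v u q
    proof (cases "v = w")
      case True
      then show ?thesis using 1 that by blast
    next
      case False
      then have "v \<in> elems D" using that(1) C(2) by simp
      then show ?thesis using D_down that by blast
    qed
    have "forcing_on Y A B R C K"
      unfolding forcing_on_def
    proof (intro conjI ballI impI)
      fix v assume "v \<in> elems C"
      then show "v \<in> elems Y" using C(2) D 1(2) by auto
    next
      fix v u p assume "v \<in> elems C" "u \<in> elems Y" "p \<in> elems A" "kpair u p \<in> elems v"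
      then show "u \<in> elems C" using preds C(2) by blast
    next
      fix v a p assume v: "v \<in> elems C" and ap: "a \<in> elems Y" "p \<in> elems B"
      have "force_eq Y A B R K v a p \<longleftrightarrow> force_eq Y A B R F v a p"
      proof (rule force_eq_cong)
        show "elems a \<subseteq> elems Y"
          using Y(2) ap(1) unfolding transitive_set_def by blast
      qed (use preds v K_D in blast)
      moreover have "kpair v (kpair a p) \<in> elems K \<longleftrightarrow> force_eq Y A B R F v a p"
      proof (cases "v \<in> elems D")
        case True
        then have "v \<in> elems Y" by (simp add: D)
        then show ?thesis
          using K[OF ap, of v] F_step[OF True ap] True by auto
      next
        case False
        then have "v = w" using v C(2) by simp
        then show ?thesis
          using K[OF ap, of v] False 1(2) by simp
      qed
      ultimately show "kpair v (kpair a p) \<in> elems K \<longleftrightarrow> force_eq Y A B R K v a p"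
        by blast
    qed
    then have "good C K" using C(1) KM by (simp add: good_def)
    then show ?case using D 1 C(2) by blast
  qed
  then have "elems D = elems Y" using D by blast
  then have "forcing_on Y A B R Y F"
    unfolding forcing_on_def using F_step by simp
  then show ?thesis using that FM by blast
qed

end

locale forcing_relation = forcing +
  fixes Y F :: hc
  assumes Y_closed: "Y \<in> M" and Y_transitive: "transitive_set (elems Y)"
    and F_closed: "F \<in> M" and forcing_on_Y: "forcing_on Y A B R Y F"
begin

lemma forces_iff:
  "w \<in> elems Y \<Longrightarrow> a \<in> elems Y \<Longrightarrow> p \<in> elems B \<Longrightarrow>
     kpair w (kpair a p) \<in> elems F \<longleftrightarrow> force_eq Y A B R F w a p"
  using forcing_on_Y unfolding forcing_on_def by blast

lemma forces_mono:
  assumes "w \<in> elems Y" "a \<in> elems Y" "p \<in> elems B" "s \<in> elems B" "leq R s p"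
    and "kpair w (kpair a p) \<in> elems F"
  shows "kpair w (kpair a s) \<in> elems F"
proof -
  have "force_eq Y A B R F w a p"
    using forces_iff assms by blast
  then have "force_eq Y A B R F w a s"
    using leq_trans[OF _ assms(5)] unfolding force_eq_def by blast
  then show ?thesis
    using forces_iff assms by blast
qed

lemma elem_of_Y: "a \<in> elems Y \<Longrightarrow> b \<in> elems a \<Longrightarrow> b \<in> elems Y"
  using Y_transitive by (rule transitive_setD)

lemma kpair_in_Y: "w \<in> elems Y \<Longrightarrow> kpair u q \<in> elems w \<Longrightarrow> u \<in> elems Y"
  using transitive_set_kpairD[OF Y_transitive] elem_of_Y by blast

lemma elem_at_mono:
  assumes "u \<in> elems Y" "a \<in> elems Y" "p \<in> elems B" "s \<in> elems B" "leq R s p" "elem_at F u a p"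
  shows "elem_at F u a s"
  using assms forces_mono elem_of_Y unfolding elem_at_def by blast

lemma val_at_mono:
  assumes "b \<in> elems Y" "p \<in> elems B" "s \<in> elems B" "leq R s p" "val_at Y A R F w b p"
  shows "val_at Y A R F w b s"
  using assms forces_mono leq_trans unfolding val_at_def by blast

lemma elem_at_set:
  assumes "u \<in> elems Y" "a \<in> elems Y"
  shows "hset {s \<in> elems B. elem_at F u a s} \<in> M"
  by (rule separationI[of "\<lambda>M s. elem_at (s 1) (s 2) (s 3) (s 0)" _ "[F, u, a]"])
    (use assms B_closed F_closed Y_closed elem_closed in \<open>simp_all add: sep_preds_def numeral_eq_Suc\<close>)

lemma val_at_set:
  assumes "w \<in> elems Y" "b \<in> elems Y"
  shows "hset {s \<in> elems B. val_at Y A R F w b s} \<in> M"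
  by (rule separationI[of "\<lambda>M s. val_at (s 1) (s 2) (s 3) (s 4) (s 5) (s 6) (s 0)" _
        "[Y, A, R, F, w, b]"])
    (use assms A_closed B_closed R_closed F_closed Y_closed elem_closed in
      \<open>simp_all add: sep_preds_def numeral_eq_Suc\<close>)

lemma elem_at_iff:
  assumes "a \<in> elems Y"
    and "\<And>b. b \<in> elems Y \<Longrightarrow> val G u = b \<longleftrightarrow> (\<exists>p\<in>G. kpair u (kpair b p) \<in> elems F)"
  shows "val G u \<in> elems a \<longleftrightarrow> (\<exists>s\<in>G. elem_at F u a s)"
  using assms elem_of_Y unfolding elem_at_def by blast

text \<open>The last hypothesis is the truth lemma for the names occurring in \<open>w\<close>.
  Stated this way, the equivalence serves inside the induction for \<open>truth\<close> and, once
  that is done, in \<open>val_at_truth\<close>.\<close>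

lemma val_at_iff:
  assumes G: "is_generic G" and "w \<in> elems Y" "b \<in> elems Y"
    and IH: "\<And>u q. kpair u q \<in> elems w \<Longrightarrow>
      val G u = b \<longleftrightarrow> (\<exists>p\<in>G. kpair u (kpair b p) \<in> elems F)"
  shows "b \<in> elems (val G w) \<longleftrightarrow> (\<exists>s\<in>G. val_at Y A R F w b s)"
proof
  assume "b \<in> elems (val G w)"
  then obtain u q where u: "q \<in> G" "kpair u q \<in> elems w" "val G u = b"
    by (auto simp: elems_val)
  then obtain p where p: "p \<in> G" "kpair u (kpair b p) \<in> elems F"
    using IH by blast
  obtain s where s: "s \<in> G" "s \<in> elems B" "leq R s p" "leq R s q"
    using generic_common_lower[OF G p(1) u(1)] .
  have "u \<in> elems Y" using kpair_in_Y assms(2) u(2) by blast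
  then have "kpair u (kpair b s) \<in> elems F"
    using forces_mono assms(3) generic_subset_B[OF G p(1)] s(2,3) p(2) by blast
  then have "val_at Y A R F w b s"
    using \<open>u \<in> elems Y\<close> u(2) s(4) leq_carrier unfolding val_at_def by blast
  then show "\<exists>s\<in>G. val_at Y A R F w b s" using s(1) by blast
next
  assume "\<exists>s\<in>G. val_at Y A R F w b s"
  then obtain s u q where s: "s \<in> G" "kpair u q \<in> elems w" "leq R s q" "kpair u (kpair b s) \<in> elems F"
    unfolding val_at_def by blast
  then have "val G u = b" "q \<in> G"
    using IH generic_facts(4)[OF G] by blast+
  then show "b \<in> elems (val G w)"
    using s(2) by (auto simp: elems_val)
qed

text \<open>Induction on names. A forced equality is true because the dense witnesses required by
  \<open>force_eq\<close> are met by \<open>G\<close>; conversely, \<open>G\<close> contains a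
  deciding condition, and a true equality cannot have been refuted by it.\<close>

lemma truth:
  assumes G: "is_generic G" and "w \<in> elems Y" "a \<in> elems Y"
  shows "val G w = a \<longleftrightarrow> (\<exists>p\<in>G. kpair w (kpair a p) \<in> elems F)"
  using assms(2,3)
proof (induction w arbitrary: a rule: hc_mem_induct_kpair)
  case (1 w)
  note w = 1(2) and a = 1(3)
  have IH: "val G u = b \<longleftrightarrow> (\<exists>p\<in>G. kpair u (kpair b p) \<in> elems F)"
    if "kpair u q \<in> elems w" "b \<in> elems Y" for u q b
    using 1(1)[OF that(1) kpair_in_Y[OF w that(1)] that(2)] .
  have elem_at_iff': "val G u \<in> elems a \<longleftrightarrow> (\<exists>s\<in>G. elem_at F u a s)"
    if "kpair u q \<in> elems w" for u q
    by (rule elem_at_iff[OF a IH[OF that]])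
  have val_at_iff': "b \<in> elems (val G w) \<longleftrightarrow> (\<exists>s\<in>G. val_at Y A R F w b s)"
    if "b \<in> elems Y" for b
    by (rule val_at_iff[OF G w that IH[OF _ that]])
  show ?case
  proof
    assume "\<exists>p\<in>G. kpair w (kpair a p) \<in> elems F"
    then obtain p where p: "p \<in> G" "kpair w (kpair a p) \<in> elems F" by blast
    have force: "force_eq Y A B R F w a p"
      using forces_iff[OF w a generic_subset_B[OF G p(1)]] p(2) by simp
    have "elems (val G w) \<subseteq> elems a"
    proof
      fix x assume "x \<in> elems (val G w)"
      then obtain u q where u: "q \<in> G" "kpair u q \<in> elems w" "x = val G u"
        by (auto simp: elems_val)
      obtain r where r: "r \<in> G" "r \<in> elems B" "leq R r p" "leq R r q"
        using generic_common_lower[OF G p(1) u(1)] .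
      define E where "E = hset {s \<in> elems B. elem_at F u a s}"
      have uY: "u \<in> elems Y" using kpair_in_Y w u(2) by blast
      have E: "E \<in> M" "elems E = {s \<in> elems B. elem_at F u a s}"
        unfolding E_def by (rule elem_at_set[OF uY a], rule elems_downset)
      have dense: "\<exists>s\<in>elems E. leq R s r'" if r': "r' \<in> elems B" "leq R r' r" for r'
      proof -
        have "leq R r' p" "leq R r' q" using r r' leq_trans by blast+
        moreover have "q \<in> elems A" using r(4) leq_carrier by blast
        ultimately obtain s where "s \<in> elems B" "leq R s r'" "elem_at F u a s"
          using force uY u(2) r'(1) unfolding force_eq_def by blast
        then show ?thesis using E(2) by blast
      qed
      obtain d where "d \<in> G" "d \<in> elems E"
        using generic_dense_below[OF G r(1) E(1) _ dense] E(2) by blast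
      then show "x \<in> elems a"
        using elem_at_iff'[OF u(2)] u(3) E(2) by blast
    qed
    moreover have "elems a \<subseteq> elems (val G w)"
    proof
      fix b assume b: "b \<in> elems a"
      have bY: "b \<in> elems Y" using b a elem_of_Y by blast
      define E where "E = hset {s \<in> elems B. val_at Y A R F w b s}"
      have E: "E \<in> M" "elems E = {s \<in> elems B. val_at Y A R F w b s}"
        unfolding E_def by (rule val_at_set[OF w bY], rule elems_downset)
      have dense: "\<exists>s\<in>elems E. leq R s r" if r: "r \<in> elems B" "leq R r p" for r
      proof -
        obtain s where "s \<in> elems B" "leq R s r" "val_at Y A R F w b s"
          using force b r unfolding force_eq_def by blast
        then show ?thesis using E(2) by blast
      qed
      obtain d where "d \<in> G" "d \<in> elems E"
        using generic_dense_below[OF G p(1) E(1) _ dense] E(2) by blast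
      then show "b \<in> elems (val G w)"
        using val_at_iff'[OF bY] E(2) by blast
    qed
    ultimately show "val G w = a"
      by (simp add: hc_extensionality)
  next
    \<comment> \<open>For a deciding \<open>d\<close> in \<open>G\<close>, the two refuting cases of
      \<open>decided\<close> are excluded: truth gives a witness in \<open>G\<close>, and a common
      lower bound of that witness and \<open>d\<close> contradicts the refutation.\<close>
    assume val: "val G w = a"
    define D where "D = hset {d \<in> elems B. decided Y A B R F w a d}"
    have D: "elems D = {d \<in> elems B. decided Y A B R F w a d}"
      unfolding D_def by (rule elems_downset)
    have DM: "D \<in> M"
      unfolding D_def
      by (rule separationI[of "\<lambda>M s. decided (s 1) (s 2) (s 3) (s 4) (s 5) (s 6) (s 7) (s 0)" _
            "[Y, A, B, R, F, w, a]"])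
        (use w a A_closed B_closed R_closed F_closed Y_closed elem_closed in
          \<open>simp_all add: sep_preds_def numeral_eq_Suc\<close>)
    have dense: "\<exists>d\<in>elems D. leq R d x" if x: "x \<in> elems B" for x
    proof (cases "kpair w (kpair a x) \<in> elems F")
      case True
      then have "x \<in> elems D" using x D unfolding decided_def by blast
      then show ?thesis using leq_refl x B_iff by blast
    next
      case False
      then have "\<not> force_eq Y A B R F w a x" using forces_iff w a x by blast
      then obtain r where "r \<in> elems B" "leq R r x" "decided Y A B R F w a r"
        unfolding force_eq_def decided_def by blast
      then show ?thesis using D by blast
    qed
    obtain d where d: "d \<in> elems D" "d \<in> G"
      using generic_meets_dense[OF G DM _ dense] D by blast
    have "\<exists>s\<in>elems B. leq R s d \<and> elem_at F u a s"
      if uY: "u \<in> elems Y" and u: "kpair u q \<in> elems w" and q: "leq R d q" for u q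
    proof -
      have "q \<in> G" using generic_facts(4)[OF G d(2) q] .
      then have "val G u \<in> elems a"
        using u val by (auto simp: elems_val[of G w, unfolded val])
      then obtain s where s: "s \<in> G" "elem_at F u a s"
        using elem_at_iff'[OF u] by blast
      obtain z where "z \<in> elems B" "leq R z s" "leq R z d"
        using generic_common_lower[OF G s(1) d(2)] .
      then show ?thesis
        using elem_at_mono[OF uY a generic_subset_B[OF G s(1)]] s(2) by blast
    qed
    moreover have "\<exists>s\<in>elems B. leq R s d \<and> val_at Y A R F w b s" if b: "b \<in> elems a" for b
    proof -
      have bY: "b \<in> elems Y" using b a elem_of_Y by blast
      then obtain s where s: "s \<in> G" "val_at Y A R F w b s"
        using val_at_iff' b val by blast
      obtain z where "z \<in> elems B" "leq R z s" "leq R z d"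
        using generic_common_lower[OF G s(1) d(2)] .
      then show ?thesis
        using val_at_mono[OF bY generic_subset_B[OF G s(1)]] s(2) by blast
    qed
    moreover have "decided Y A B R F w a d" using d(1) D by blast
    ultimately have "kpair w (kpair a d) \<in> elems F"
      unfolding decided_def by blast
    then show "\<exists>p\<in>G. kpair w (kpair a p) \<in> elems F" using d(2) by blast
  qed
qed

lemma val_at_truth:
  assumes "is_generic G" "w \<in> elems Y" "b \<in> elems Y"
  shows "b \<in> elems (val G w) \<longleftrightarrow> (\<exists>s\<in>G. val_at Y A R F w b s)"
  by (rule val_at_iff[OF assms]) (use assms truth kpair_in_Y in blast)

end

section \<open>A name for the generic filter and Boolean values of membership\<close>

lemma app_eqI:
  assumes "is_function f X Z" "x \<in> elems X"
  shows "app f x \<in> elems Z" "kpair x y \<in> elems f \<longleftrightarrow> y = app f x"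
proof -
  have ex1: "\<exists>!y. kpair x y \<in> elems f"
    using assms unfolding is_function_def by blast
  have app: "kpair x (app f x) \<in> elems f"
    unfolding app_def using theI'[OF ex1] .
  then show "app f x \<in> elems Z"
    using assms(1) unfolding is_function_def by force
  show "kpair x y \<in> elems f \<longleftrightarrow> y = app f x"
    using app ex1 by blast
qed

context forcing
begin

lemma ex_forcing_relation_at:
  assumes "t \<in> M"
  obtains Y F where "forcing_relation M A R Y F" "t \<in> elems Y" "A \<in> elems Y"
proof -
  \<comment> \<open>Starting from the pair places both \<open>t\<close> and \<open>A\<close> in one
    transitive set.\<close>
  obtain Y where Y: "Y \<in> M" "kpair t A \<in> elems Y" "transitive_set (elems Y)"
    using ex_transitive_superset[OF kpair_closed[OF assms A_closed]] .
  obtain F where F: "F \<in> M" "forcing_on Y A B R Y F"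
    using ex_forcing_relation[OF Y(1,3)] .
  have "forcing_relation M A R Y F"
    by unfold_locales (fact Y F)+
  then show ?thesis
    using that transitive_set_kpairD[OF Y(3,2)] by blast
qed

lemma is_name_memberD:
  assumes "is_name A t" "kpair u p \<in> elems t"
  shows "is_name A u" "p \<in> elems A"
proof -
  have "\<exists>u' p'. kpair u p = kpair u' p' \<and> is_name A u' \<and> p' \<in> elems A"
    using assms by (cases rule: is_name.cases) blast
  then show "is_name A u" "p \<in> elems A" by auto
qed

text \<open>The usual name pairs the check name of each \<open>a\<close> with \<open>a\<close>
  itself. Here \<open>t\<close> denotes \<open>A\<close>, so every \<open>a\<close> is the value of
  some \<open>w\<close> occurring in \<open>t\<close>, and \<open>w\<close> is paired with the
  conditions below \<open>a\<close> that force it to denote \<open>a\<close>.\<close>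

lemma generic_filter_has_name:
  assumes G: "is_generic G" and t: "t \<in> M" "is_name A t" "val G t = A"
  obtains s where "s \<in> M" "is_name A s" "val G s = hset G"
proof -
  obtain Y F where rel: "forcing_relation M A R Y F" and tY: "t \<in> elems Y" and AY: "A \<in> elems Y"
    using ex_forcing_relation_at[OF t(1)] .
  interpret forcing_relation M A R Y F by (rule rel)
  define T where "T = hc_prod Y B"
  have TM: "T \<in> M" unfolding T_def by (intro hc_prod_closed Y_closed B_closed)
  define s where "s = hset {z \<in> elems T. generic_name Y A B R F t z}"
  have sM: "s \<in> M"
    unfolding s_def
    by (rule separationI[of "\<lambda>M s. generic_name (s 1) (s 2) (s 3) (s 4) (s 5) (s 6) (s 0)" _
          "[Y, A, B, R, F, t]"])
      (use t TM A_closed B_closed R_closed F_closed Y_closed elem_closed in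
        \<open>simp_all add: sep_preds_def numeral_eq_Suc\<close>)
  have s: "z \<in> elems s \<longleftrightarrow> z \<in> elems T \<and> generic_name Y A B R F t z" for z
    unfolding s_def by (subst elems_hset) auto
  have s_kpair: "kpair w r \<in> elems s \<longleftrightarrow> w \<in> elems Y \<and> r \<in> elems B \<and>
        (\<exists>p\<in>elems A. kpair w p \<in> elems t \<and> leq R r p) \<and>
        (\<exists>a\<in>elems A. leq R r a \<and> kpair w (kpair a r) \<in> elems F)" for w r
    unfolding s T_def generic_name_def by auto
  have "is_name A s"
  proof (rule is_name.intros)
    fix z assume "z \<in> elems s"
    then obtain w r p where "z = kpair w r" "r \<in> elems B" "kpair w p \<in> elems t"
      unfolding s generic_name_def by blast
    then show "\<exists>u p. z = kpair u p \<and> is_name A u \<and> p \<in> elems A"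
      using is_name_memberD(1)[OF t(2)] B_iff by blast
  qed
  moreover have "elems (val G s) = G"
  proof
    show "elems (val G s) \<subseteq> G"
    proof
      fix x assume "x \<in> elems (val G s)"
      then obtain w r where w: "r \<in> G" "kpair w r \<in> elems s" "x = val G w"
        by (auto simp: elems_val)
      then obtain a where a: "w \<in> elems Y" "a \<in> elems A" "leq R r a" "kpair w (kpair a r) \<in> elems F"
        using s_kpair by blast
      then have "val G w = a"
        using truth[OF G a(1) elem_of_Y[OF AY a(2)]] w(1) by blast
      then show "x \<in> G"
        using w(1,3) a(3) generic_facts(4)[OF G] by blast
    qed
  next
    show "G \<subseteq> elems (val G s)"
    proof
      fix a assume a: "a \<in> G"
      then have aA: "a \<in> elems A" using generic_facts(1)[OF G] by blast
      then obtain w p where w: "p \<in> G" "kpair w p \<in> elems t" "val G w = a"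
        using elems_val[of G t, unfolded t(3)] by auto
      have wY: "w \<in> elems Y" using kpair_in_Y tY w(2) by blast
      have aY: "a \<in> elems Y" using elem_of_Y AY aA by blast
      obtain r where r: "r \<in> G" "kpair w (kpair a r) \<in> elems F"
        using truth[OF G wY aY] w(3) by blast
      obtain r' where r': "r' \<in> G" "r' \<in> elems B" "leq R r' r" "leq R r' p"
        using generic_common_lower[OF G r(1) w(1)] .
      \<comment> \<open>The condition \<open>q\<close> has to lie below three elements of
        \<open>G\<close>: below \<open>p\<close> because of the pair in \<open>t\<close>, below
        \<open>r\<close> to force the value of \<open>w\<close>, and below \<open>a\<close>
        itself.\<close>
      obtain q where q: "q \<in> G" "q \<in> elems B" "leq R q r'" "leq R q a"
        using generic_common_lower[OF G r'(1) a] .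
      have "leq R q r" "leq R q p" using q r' leq_trans by blast+
      moreover from this(1) have "kpair w (kpair a q) \<in> elems F"
        using forces_mono[OF wY aY generic_subset_B[OF G r(1)] q(2)] r(2) by blast
      ultimately have "kpair w q \<in> elems s"
        unfolding s_kpair using wY q(2,4) w(2) aA leq_carrier by blast
      then show "a \<in> elems (val G s)"
        using q(1) w(3) by (auto simp: elems_val)
    qed
  qed
  then have "val G s = hset G" by (metis hset_elems)
  ultimately show ?thesis using that sM by blast
qed

text \<open>The value at \<open>a\<close> is the supremum of the conditions witnessing membership of
  \<open>a\<close>. It exists by completeness in \<open>M\<close>, and a generic filter contains it
  exactly if it contains one of the witnesses.\<close>

lemma ex_boolean_values:
  assumes t: "t \<in> M"
  obtains f where "f \<in> M" "is_function f A A"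
    "\<And>G a. is_generic G \<Longrightarrow> a \<in> elems A \<Longrightarrow> app f a \<in> G \<longleftrightarrow> a \<in> elems (val G t)"
proof -
  obtain Y F where rel: "forcing_relation M A R Y F" and tY: "t \<in> elems Y" and AY: "A \<in> elems Y"
    using ex_forcing_relation_at[OF t] .
  interpret forcing_relation M A R Y F by (rule rel)
  define X where "X a = hset {s \<in> elems B. val_at Y A R F t a s}" for a
  have X: "X a \<in> M" "elems (X a) = {s \<in> elems B. val_at Y A R F t a s}" if "a \<in> elems A" for a
    unfolding X_def by (rule val_at_set[OF tY elem_of_Y[OF AY that]], rule elems_downset)
  have X_sub: "elems (X a) \<subseteq> elems A" if "a \<in> elems A" for a
    using X(2)[OF that] B_iff by blast
  define f where "f = hset {z \<in> elems (hc_prod A A). bool_value Y A B R F t z}"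
  have fM: "f \<in> M"
    unfolding f_def
    by (rule separationI[of "\<lambda>M s. bool_value (s 1) (s 2) (s 3) (s 4) (s 5) (s 6) (s 0)" _
          "[Y, A, B, R, F, t]"])
      (use t hc_prod_closed A_closed B_closed R_closed F_closed Y_closed in
        \<open>simp_all add: sep_preds_def numeral_eq_Suc\<close>)
  have f_elems: "z \<in> elems f \<longleftrightarrow> z \<in> elems (hc_prod A A) \<and> bool_value Y A B R F t z" for z
    unfolding f_def by (subst elems_hset) auto
  have f: "kpair a b \<in> elems f \<longleftrightarrow> is_lub b (elems (X a))" if "a \<in> elems A" for a b
    unfolding f_elems bool_value_def is_lub_def X(2)[OF that] using that by auto
  have lub_unique: "b = c" if "is_lub b Z" "is_lub c Z" for b c Z
    using that leq_antisym unfolding is_lub_def by blast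
  have f_fun: "is_function f A A"
    unfolding is_function_def
  proof (intro conjI ballI)
    fix z assume "z \<in> elems f"
    then show "\<exists>x\<in>elems A. \<exists>y\<in>elems A. z = kpair x y"
      unfolding f_elems bool_value_def by blast
  next
    fix a assume a: "a \<in> elems A"
    obtain b where "is_lub b (elems (X a))"
      using lub_exists[OF X(1)[OF a] X_sub[OF a]] .
    then show "\<exists>!b. kpair a b \<in> elems f"
      using f[OF a] lub_unique by blast
  qed
  have "app f a \<in> G \<longleftrightarrow> a \<in> elems (val G t)" if G: "is_generic G" and a: "a \<in> elems A" for G a
  proof -
    have "is_lub (app f a) (elems (X a))"
      using app_eqI(2)[OF f_fun a] f[OF a] by blast
    then have "app f a \<in> G \<longleftrightarrow> (\<exists>s\<in>elems (X a). s \<in> G)"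
      by (rule generic_lub_iff[OF G X(1)[OF a] X_sub[OF a]])
    also have "\<dots> \<longleftrightarrow> (\<exists>s\<in>G. val_at Y A R F t a s)"
      using X(2)[OF a] generic_subset_B[OF G] by blast
    also have "\<dots> \<longleftrightarrow> a \<in> elems (val G t)"
      using val_at_truth[OF G tY elem_of_Y[OF AY a]] by simp
    finally show ?thesis .
  qed
  then show ?thesis using that fM f_fun by blast
qed

end

section \<open>Two generic filters generating the same extension\<close>

context forcing
begin

lemma generic_meet_iff:
  assumes "is_generic G" "a \<in> elems A" "b \<in> elems A"
  shows "meet a b \<in> G \<longleftrightarrow> a \<in> G \<and> b \<in> G"
  using S_meet[OF assms(2,3)] assms(1) unfolding S_def by blast

text \<open>The filter \<open>G\<close> cannot distinguish the two sides of either identity, because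
  its preimage under \<open>f\<close> is the filter \<open>H\<close>, whose preimage under
  \<open>g\<close> is \<open>G\<close>. The set \<open>P\<close> of all pairs of sides is in
  \<open>M\<close>, so \<open>generic_agree\<close> turns this into identities below one
  condition.\<close>

lemma local_homomorphism:
  assumes f: "f \<in> M" "is_function f A A" and g: "g \<in> M" "is_function g A A"
    and G: "is_generic G" and H: "is_generic H"
    and fG: "\<And>a. a \<in> elems A \<Longrightarrow> app f a \<in> G \<longleftrightarrow> a \<in> H"
    and gH: "\<And>a. a \<in> elems A \<Longrightarrow> app g a \<in> H \<longleftrightarrow> a \<in> G"
  obtains p where "p \<in> G"
    "\<And>a b. a \<in> elems A \<Longrightarrow> b \<in> elems A \<Longrightarrow>
       S p \<inter> S (app f (meet a b)) = S p \<inter> S (app f a) \<inter> S (app f b)"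
    "\<And>a. a \<in> elems A \<Longrightarrow> S p \<inter> S (app f (app g a)) = S p \<inter> S a"
proof -
  note f_app = app_eqI[OF f(2)] and g_app = app_eqI[OF g(2)]
  define P where "P = hset {z \<in> elems (hc_prod A A). unseparated A R f g z}"
  have PM: "P \<in> M"
    unfolding P_def
    by (rule separationI[of "\<lambda>M s. unseparated (s 1) (s 2) (s 3) (s 4) (s 0)" _ "[A, R, f, g]"])
      (use f(1) g(1) A_closed R_closed hc_prod_closed in \<open>simp_all add: sep_preds_def numeral_eq_Suc\<close>)
  have P: "kpair u v \<in> elems P \<longleftrightarrow> u \<in> elems A \<and> v \<in> elems A \<and>
        (u = app f (app g v) \<or>
         (\<exists>a\<in>elems A. \<exists>b\<in>elems A. u = app f (meet a b) \<and> v = meet (app f a) (app f b)))" for u v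
  proof -
    let ?inverse = "\<exists>c\<in>elems A. kpair v c \<in> elems g \<and> kpair c u \<in> elems f"
    let ?meets = "\<exists>a\<in>elems A. \<exists>b\<in>elems A. \<exists>m\<in>elems A. \<exists>x\<in>elems A. \<exists>y\<in>elems A.
            is_meet A R m a b \<and> kpair m u \<in> elems f \<and>
            kpair a x \<in> elems f \<and> kpair b y \<in> elems f \<and> is_meet A R v x y"
    have "kpair u v \<in> elems P \<longleftrightarrow> kpair u v \<in> elems (hc_prod A A) \<and> unseparated A R f g (kpair u v)"
      unfolding P_def by (subst elems_hset) auto
    also have "\<dots> \<longleftrightarrow> u \<in> elems A \<and> v \<in> elems A \<and> (?inverse \<or> ?meets)"
      unfolding unseparated_def kpair_inject kpair_in_hc_prod by blast
    also have "\<dots> \<longleftrightarrow> u \<in> elems A \<and> v \<in> elems A \<and> (u = app f (app g v) \<or>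
         (\<exists>a\<in>elems A. \<exists>b\<in>elems A. u = app f (meet a b) \<and> v = meet (app f a) (app f b)))"
    proof (cases "v \<in> elems A")
      case True
      have "?inverse \<longleftrightarrow> u = app f (app g v)"
        using True f_app g_app by auto
      moreover have "?meets \<longleftrightarrow>
          (\<exists>a\<in>elems A. \<exists>b\<in>elems A. u = app f (meet a b) \<and> v = meet (app f a) (app f b))"
        using True f_app meet_in by (simp add: is_meet_iff cong: bex_cong)
      ultimately show ?thesis by simp
    qed simp
    finally show ?thesis .
  qed
  have same: "u \<in> G \<longleftrightarrow> v \<in> G" if "kpair u v \<in> elems P" for u v
    using that[unfolded P]
  proof (elim conjE disjE bexE)
    assume "v \<in> elems A" "u = app f (app g v)"
    then show ?thesis using fG gH g_app(1) by simp
  next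
    fix a b assume "a \<in> elems A" "b \<in> elems A" "u = app f (meet a b)" "v = meet (app f a) (app f b)"
    then show ?thesis
      using fG meet_in f_app(1) by (simp add: generic_meet_iff G H)
  qed
  obtain p where p: "p \<in> G"
    "\<And>u v. u \<in> elems A \<Longrightarrow> v \<in> elems A \<Longrightarrow> kpair u v \<in> elems P \<Longrightarrow> S p \<inter> S u = S p \<inter> S v"
    using generic_agree[OF G PM same] by blast
  show ?thesis
  proof
    show "p \<in> G" by fact
    show "S p \<inter> S (app f (meet a b)) = S p \<inter> S (app f a) \<inter> S (app f b)"
      if "a \<in> elems A" "b \<in> elems A" for a b
    proof -
      have "S p \<inter> S (app f (meet a b)) = S p \<inter> S (meet (app f a) (app f b))"
        by (rule p(2)) (use that f_app(1) meet_in P in auto)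
      then show ?thesis using that f_app(1) by (simp add: S_meet Int_assoc)
    qed
    show "S p \<inter> S (app f (app g a)) = S p \<inter> S a" if "a \<in> elems A" for a
      by (rule p(2)) (use that f_app(1) g_app(1) P in auto)
  qed
qed

text \<open>
  The map \<open>b \<mapsto> f b \<sqinter> p\<close> on the part of the algebra below \<open>q\<close> is inverted by \<open>g\<close>.
\<close>

lemma local_inverse:
  assumes f: "\<And>a. a \<in> elems A \<Longrightarrow> f a \<in> elems A" and g: "\<And>a. a \<in> elems A \<Longrightarrow> g a \<in> elems A"
    and fm: "\<And>a b. a \<in> elems A \<Longrightarrow> b \<in> elems A \<Longrightarrow> S p \<inter> S (f (meet a b)) = S p \<inter> S (f a) \<inter> S (f b)"
    and fg: "\<And>a. a \<in> elems A \<Longrightarrow> S p \<inter> S (f (g a)) = S p \<inter> S a"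
    and sub: "S p \<subseteq> S (f q)" and q: "q \<in> elems A"
    and b: "b \<in> elems A" and c: "c \<in> elems A" "S c \<inter> S q = S (g b) \<inter> S q"
  shows "S p \<inter> S (f c) = S p \<inter> S b"
proof -
  have "S (meet c q) = S (meet (g b) q)"
    using c q g[OF b] by (simp add: S_meet)
  then have eq: "meet c q = meet (g b) q"
    using S_inject meet_in c(1) q g[OF b] by blast
  have "S p \<inter> S (f c) = S p \<inter> S (f c) \<inter> S (f q)" using sub by blast
  also have "\<dots> = S p \<inter> S (f (meet (g b) q))"
    using fm[OF c(1) q] eq by simp
  also have "\<dots> = S p \<inter> S (f (g b)) \<inter> S (f q)" using fm[OF g[OF b] q] .
  also have "\<dots> = S p \<inter> S b" using fg[OF b] sub by blast
  finally show ?thesis .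
qed

lemma S_subset_generic: "S a \<subseteq> Collect is_generic"
  unfolding S_def by blast

text \<open>An element of \<open>H\<close> outside \<open>G\<close> would have its complement in the
  ultrafilter \<open>G\<close>, hence also in \<open>H\<close>.\<close>

lemma generic_eqI:
  assumes G: "is_generic G" and H: "is_generic H" and sub: "G \<subseteq> H"
  shows "G = H"
proof (rule ccontr)
  assume "G \<noteq> H"
  then obtain x where x: "x \<in> H" "x \<notin> G" using sub by blast
  then have "x \<in> elems A" using generic_facts(1)[OF H] by blast
  then obtain c where c: "c \<in> elems A" "S c = Collect is_generic - S x"
    using complementE by blast
  then have "c \<in> G" "c \<notin> H" using G H x unfolding S_def by blast+
  then show False using sub by blast
qed

text \<open>By \<open>generic_eqI\<close> some \<open>r\<close> in \<open>G\<close> is missing from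
  \<open>H\<close>; its complement serves as \<open>r'\<close>.\<close>

lemma generic_separate:
  assumes "is_generic G" "is_generic H" "G \<noteq> H"
  obtains r r' where "r \<in> G" "r' \<in> H" "S r \<inter> S r' = {}"
proof -
  obtain r where r: "r \<in> G" "r \<notin> H" using generic_eqI assms by blast
  then have "r \<in> elems A" using generic_facts(1) assms(1) by blast
  then obtain r' where r': "r' \<in> elems A" "S r' = Collect is_generic - S r"
    using complementE by blast
  then have "r' \<in> H" using assms(2) r(2) unfolding S_def by blast
  moreover have "S r \<inter> S r' = {}" using r'(2) by blast
  ultimately show ?thesis using that r(1) by blast
qed

text \<open>The inclusions in \<open>pq\<close> make \<open>f\<close> and \<open>g\<close> match the
  part of the algebra below \<open>q\<close> with the part below \<open>p\<close>. Swapping the two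
  parts and fixing the rest is possible in a rigid algebra only if the parts are trivial.\<close>

lemma no_local_isomorphism:
  assumes rigid: "rigid_in M A R"
    and f: "f \<in> M" "is_function f A A" and g: "g \<in> M" "is_function g A A"
    and p: "p \<in> elems A" and q: "q \<in> elems A"
    and fm: "\<And>a b. a \<in> elems A \<Longrightarrow> b \<in> elems A \<Longrightarrow>
      S p \<inter> S (app f (meet a b)) = S p \<inter> S (app f a) \<inter> S (app f b)"
    and fg: "\<And>a. a \<in> elems A \<Longrightarrow> S p \<inter> S (app f (app g a)) = S p \<inter> S a"
    and gm: "\<And>a b. a \<in> elems A \<Longrightarrow> b \<in> elems A \<Longrightarrow>
      S q \<inter> S (app g (meet a b)) = S q \<inter> S (app g a) \<inter> S (app g b)"
    and gf: "\<And>a. a \<in> elems A \<Longrightarrow> S q \<inter> S (app g (app f a)) = S q \<inter> S a"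
    and pq: "S p \<subseteq> S (app f q)" "S q \<subseteq> S (app g p)" "S p \<inter> S q = {}"
  shows "S p = {}"
proof -
  note f_app = app_eqI[OF f(2)] and g_app = app_eqI[OF g(2)]
  obtain j where j: "j \<in> elems A" "S j = S p \<union> S q" using joinE[OF p q] .
  obtain r where r: "r \<in> elems A" "S r = Collect is_generic - (S p \<union> S q)"
    using complementE[OF j(1)] j(2) by metis
  have "\<exists>c\<in>elems A. S c = (S (app f b) \<inter> S p) \<union> (S (app g b) \<inter> S q) \<union> (S b \<inter> S r)"
    if b: "b \<in> elems A" for b
  proof -
    obtain x where x: "x \<in> elems A" "S x = S (meet (app f b) p) \<union> S (meet (app g b) q)"
      using joinE[OF meet_in[OF f_app(1)[OF b] p] meet_in[OF g_app(1)[OF b] q]] .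
    obtain c where "c \<in> elems A" "S c = S x \<union> S (meet b r)"
      using joinE[OF x(1) meet_in[OF b r(1)]] .
    then show ?thesis
      using x(2) b f_app(1) g_app(1) p q r(1) by (auto simp: S_meet)
  qed
  then obtain \<sigma> where \<sigma>: "\<And>b. b \<in> elems A \<Longrightarrow> \<sigma> b \<in> elems A"
    "\<And>b. b \<in> elems A \<Longrightarrow>
       S (\<sigma> b) = (S (app f b) \<inter> S p) \<union> (S (app g b) \<inter> S q) \<union> (S b \<inter> S r)"
    by metis
  have \<sigma>_p: "S (\<sigma> b) \<inter> S p = S (app f b) \<inter> S p"
    and \<sigma>_q: "S (\<sigma> b) \<inter> S q = S (app g b) \<inter> S q"
    and \<sigma>_r: "S (\<sigma> b) \<inter> S r = S b \<inter> S r" if "b \<in> elems A" for b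
    unfolding \<sigma>(2)[OF that] using pq(3) r(2) by blast+
  have partition: "S p \<union> S q \<union> S r = Collect is_generic"
    unfolding r(2) using S_subset_generic by blast
  have eqI: "b = c" if "b \<in> elems A" "c \<in> elems A" "S b \<inter> S p = S c \<inter> S p"
    "S b \<inter> S q = S c \<inter> S q" "S b \<inter> S r = S c \<inter> S r" for b c
  proof -
    have "S b = S c"
      using that(3-5) partition S_subset_generic[of b] S_subset_generic[of c] by blast
    then show ?thesis using S_inject that(1,2) by blast
  qed
  have involution: "\<sigma> (\<sigma> b) = b" if b: "b \<in> elems A" for b
  proof (rule eqI)
    note \<sigma>b = \<sigma>(1)[OF b]
    show "\<sigma> (\<sigma> b) \<in> elems A" "b \<in> elems A" using \<sigma>b \<sigma>(1) b by auto
    have "S p \<inter> S (app f (\<sigma> b)) = S p \<inter> S b"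
      by (rule local_inverse[of "app f" "app g", OF f_app(1) g_app(1) fm fg pq(1) q b \<sigma>b \<sigma>_q[OF b]])
    then show "S (\<sigma> (\<sigma> b)) \<inter> S p = S b \<inter> S p" using \<sigma>_p[OF \<sigma>b] by blast
    have "S q \<inter> S (app g (\<sigma> b)) = S q \<inter> S b"
      by (rule local_inverse[of "app g" "app f", OF g_app(1) f_app(1) gm gf pq(2) p b \<sigma>b \<sigma>_p[OF b]])
    then show "S (\<sigma> (\<sigma> b)) \<inter> S q = S b \<inter> S q" using \<sigma>_q[OF \<sigma>b] by blast
    show "S (\<sigma> (\<sigma> b)) \<inter> S r = S b \<inter> S r" using \<sigma>_r \<sigma>b b by blast
  qed
  \<comment> \<open>Preserving meets below \<open>p\<close> and \<open>q\<close> makes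
    \<open>f\<close> and \<open>g\<close> monotone there. For an involution, monotonicity in one
    direction already gives an order automorphism.\<close>
  have mono: "leq R (\<sigma> a) (\<sigma> b)" if "leq R a b" for a b
  proof -
    have ab: "a \<in> elems A" "b \<in> elems A" using leq_carrier that by auto
    have sub: "S a \<subseteq> S b" using S_leq_iff[OF ab] that by blast
    then have "meet a b = a"
      using S_inject[OF meet_in[OF ab] ab(1)] S_meet[OF ab] by blast
    then have "S p \<inter> S (app f a) \<subseteq> S (app f b)" "S q \<inter> S (app g a) \<subseteq> S (app g b)"
      using fm[OF ab] gm[OF ab] by auto
    then have "S (\<sigma> a) \<subseteq> S (\<sigma> b)"
      unfolding \<sigma>(2)[OF ab(1)] \<sigma>(2)[OF ab(2)] using sub by blast
    then show ?thesis using S_leq_iff \<sigma>(1) ab by blast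
  qed
  \<comment> \<open>The map \<open>\<sigma>\<close> was chosen outside \<open>M\<close>; its graph
    is now recovered in \<open>M\<close> by Separation, since its behaviour on \<open>p\<close>,
    \<open>q\<close> and \<open>r\<close> determines it.\<close>
  define \<Sigma> where "\<Sigma> = hset {z \<in> elems (hc_prod A A). swap_rel A B R f g p q r z}"
  have \<Sigma>M: "\<Sigma> \<in> M"
    unfolding \<Sigma>_def
    by (rule separationI[of "\<lambda>M s. swap_rel (s 1) (s 2) (s 3) (s 4) (s 5) (s 6) (s 7) (s 8) (s 0)" _
          "[A, B, R, f, g, p, q, r]"])
      (use f(1) g(1) p q r(1) A_closed B_closed R_closed hc_prod_closed elem_closed in
        \<open>simp_all add: sep_preds_def numeral_eq_Suc\<close>)
  have \<Sigma>_elems: "z \<in> elems \<Sigma> \<longleftrightarrow> z \<in> elems (hc_prod A A) \<and> swap_rel A B R f g p q r z" for z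
    unfolding \<Sigma>_def by (subst elems_hset) auto
  have \<Sigma>: "kpair b c \<in> elems \<Sigma> \<longleftrightarrow> c = \<sigma> b" if b: "b \<in> elems A" for b c
  proof -
    have "kpair b c \<in> elems \<Sigma> \<longleftrightarrow> c \<in> elems A \<and> agree B R p c (app f b) \<and>
        agree B R q c (app g b) \<and> agree B R r c b"
      unfolding \<Sigma>_elems swap_rel_def using b f_app g_app by auto
    also have "\<dots> \<longleftrightarrow> c \<in> elems A \<and> S p \<inter> S c = S p \<inter> S (app f b) \<and>
        S q \<inter> S c = S q \<inter> S (app g b) \<and> S r \<inter> S c = S r \<inter> S b"
      using agree_iff b f_app(1) g_app(1) p q r(1) by (auto cong: conj_cong)
    also have "\<dots> \<longleftrightarrow> c = \<sigma> b"
      using \<sigma>_p[OF b] \<sigma>_q[OF b] \<sigma>_r[OF b] \<sigma>(1)[OF b] eqI[of c "\<sigma> b"] by (auto simp: Int_commute)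
    finally show ?thesis .
  qed
  have \<Sigma>_fun: "is_function \<Sigma> A A"
    unfolding is_function_def
  proof (intro conjI ballI)
    fix z assume "z \<in> elems \<Sigma>"
    then show "\<exists>x\<in>elems A. \<exists>y\<in>elems A. z = kpair x y"
      unfolding \<Sigma>_elems swap_rel_def by blast
  qed (use \<Sigma> in simp)
  have app_\<Sigma>: "app \<Sigma> b = \<sigma> b" if "b \<in> elems A" for b
    using app_eqI(2)[OF \<Sigma>_fun that, of "\<sigma> b"] \<Sigma>[OF that, of "\<sigma> b"] by simp
  have "automorphism A R \<Sigma>"
    unfolding automorphism_def
  proof (intro conjI ballI)
    have "bij_betw \<sigma> (elems A) (elems A)"
      by (rule bij_betw_byWitness[of _ \<sigma>]) (use involution \<sigma>(1) in auto)
    then show "bij_betw (app \<Sigma>) (elems A) (elems A)"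
      using app_\<Sigma> by (subst bij_betw_cong) auto
    fix x y assume xy: "x \<in> elems A" "y \<in> elems A"
    show "leq R x y \<longleftrightarrow> leq R (app \<Sigma> x) (app \<Sigma> y)"
      unfolding app_\<Sigma>[OF xy(1)] app_\<Sigma>[OF xy(2)]
      using mono[of x y] mono[of "\<sigma> x" "\<sigma> y"]
      unfolding involution[OF xy(1)] involution[OF xy(2)] by (intro iffI)
  qed (fact \<Sigma>_fun)
  \<comment> \<open>Below \<open>p\<close>, the image of \<open>q\<close> agrees with
    \<open>f q\<close> and so is all of \<open>p\<close>, whereas \<open>q\<close> itself is
    disjoint from \<open>p\<close>.\<close>
  then have "\<sigma> q = q"
    using rigid \<Sigma>M app_\<Sigma>[OF q] q by (simp add: rigid_in_def)
  then show "S p = {}"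
    using \<sigma>_p[OF q] pq(1,3) by auto
qed

lemma generic_filters_equal:
  assumes rigid: "rigid_in M A R"
    and f: "f \<in> M" "is_function f A A" and g: "g \<in> M" "is_function g A A"
    and G: "is_generic G" and H: "is_generic H"
    and fG: "\<And>a. a \<in> elems A \<Longrightarrow> app f a \<in> G \<longleftrightarrow> a \<in> H"
    and gH: "\<And>a. a \<in> elems A \<Longrightarrow> app g a \<in> H \<longleftrightarrow> a \<in> G"
  shows "G = H"
proof (rule ccontr)
  assume "G \<noteq> H"
  note f_app = app_eqI(1)[OF f(2)] and g_app = app_eqI(1)[OF g(2)]
  obtain p0 where p0: "p0 \<in> G"
    and fm: "\<And>a b. a \<in> elems A \<Longrightarrow> b \<in> elems A \<Longrightarrow>
       S p0 \<inter> S (app f (meet a b)) = S p0 \<inter> S (app f a) \<inter> S (app f b)"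
    and fg: "\<And>a. a \<in> elems A \<Longrightarrow> S p0 \<inter> S (app f (app g a)) = S p0 \<inter> S a"
    using local_homomorphism[OF f g G H fG gH] by blast
  obtain q0 where q0: "q0 \<in> H"
    and gm: "\<And>a b. a \<in> elems A \<Longrightarrow> b \<in> elems A \<Longrightarrow>
       S q0 \<inter> S (app g (meet a b)) = S q0 \<inter> S (app g a) \<inter> S (app g b)"
    and gf: "\<And>a. a \<in> elems A \<Longrightarrow> S q0 \<inter> S (app g (app f a)) = S q0 \<inter> S a"
    using local_homomorphism[OF g f H G gH fG] by blast
  obtain r s where rs: "r \<in> G" "s \<in> H" "S r \<inter> S s = {}"
    using generic_separate[OF G H \<open>G \<noteq> H\<close>] .
  \<comment> \<open>First \<open>q\<close> is put below \<open>g p1\<close>, then \<open>p\<close>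
    below \<open>f q\<close>. The second shrinking keeps \<open>q\<close> below \<open>g p\<close>,
    because below \<open>q0\<close> the element \<open>g p\<close> is the meet of
    \<open>g p1\<close> with \<open>g (f q)\<close>, and \<open>g (f q)\<close> agrees there with
    \<open>q\<close>.\<close>
  define p1 where "p1 = meet p0 r"
  define q where "q = meet (meet q0 s) (app g p1)"
  define p where "p = meet p1 (app f q)"
  have GA: "\<And>x. x \<in> G \<Longrightarrow> x \<in> elems A" and HA: "\<And>x. x \<in> H \<Longrightarrow> x \<in> elems A"
    using generic_facts(1) G H by blast+
  have p1: "p1 \<in> G" unfolding p1_def using generic_facts(3)[OF G p0 rs(1)] .
  have gp1: "app g p1 \<in> H" using gH GA p1 by blast
  have q: "q \<in> H" unfolding q_def by (intro generic_facts(3)[OF H] q0 rs(2) gp1)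
  have fq: "app f q \<in> G" using fG HA q by blast
  have p: "p \<in> G" unfolding p_def by (intro generic_facts(3)[OF G] p1 fq)
  have Sp1: "S p1 = S p0 \<inter> S r"
    unfolding p1_def using S_meet GA p0 rs(1) by blast
  have Sq: "S q = S q0 \<inter> S s \<inter> S (app g p1)"
    unfolding q_def using S_meet HA q0 rs(2) gp1 meet_in by simp
  have Sp: "S p = S p1 \<inter> S (app f q)"
    unfolding p_def using S_meet GA p1 fq by blast
  have "S q \<subseteq> S (app g p)"
  proof -
    have "S q0 \<inter> S (app g p) = S q0 \<inter> S (app g p1) \<inter> S (app g (app f q))"
      unfolding p_def by (rule gm[OF GA[OF p1] GA[OF fq]])
    moreover have "S q0 \<inter> S (app g (app f q)) = S q0 \<inter> S q"
      by (rule gf[OF HA[OF q]])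
    ultimately show ?thesis using Sq by blast
  qed
  moreover have "S p \<inter> S (app f (meet a b)) = S p \<inter> S (app f a) \<inter> S (app f b)"
    if "a \<in> elems A" "b \<in> elems A" for a b
    using fm[OF that] Sp Sp1 by blast
  moreover have "S p \<inter> S (app f (app g a)) = S p \<inter> S a" if "a \<in> elems A" for a
    using fg[OF that] Sp Sp1 by blast
  moreover have "S q \<inter> S (app g (meet a b)) = S q \<inter> S (app g a) \<inter> S (app g b)"
    if "a \<in> elems A" "b \<in> elems A" for a b
    using gm[OF that] Sq by blast
  moreover have "S q \<inter> S (app g (app f a)) = S q \<inter> S a" if "a \<in> elems A" for a
    using gf[OF that] Sq by blast
  moreover have "S p \<subseteq> S (app f q)" using Sp by blast
  moreover have "S p \<inter> S q = {}" using Sp Sp1 Sq rs(3) by blast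
  ultimately have "S p = {}"
    by (intro no_local_isomorphism[OF rigid f g GA[OF p] HA[OF q]])
  moreover have "G \<in> S p" using G p unfolding S_def by blast
  ultimately show False by blast
qed

text \<open>The assumption \<open>A_in\<close> supplies a name of \<open>A\<close>, from which each
  extension gets a name of its own filter. Equality of the extensions then gives names for
  \<open>H\<close> over \<open>G\<close> and for \<open>G\<close> over \<open>H\<close>.\<close>

lemma generic_eq_if_same_extension:
  assumes rigid: "rigid_in M A R"
    and G: "is_generic G" and H: "is_generic H"
    and ext: "gen_ext M A G = gen_ext M A H"
    and A_in: "A \<in> gen_ext M A G"
  shows "G = H"
proof -
  have in_ext: "hset F \<in> gen_ext M A F" if F: "is_generic F" "A \<in> gen_ext M A F" for F
  proof -
    obtain t where t: "t \<in> M" "is_name A t" "val F t = A"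
      using F(2) unfolding gen_ext_def by auto
    obtain s where "s \<in> M" "is_name A s" "val F s = hset F"
      using generic_filter_has_name[OF F(1) t] .
    then show ?thesis unfolding gen_ext_def by (auto intro: image_eqI[of _ _ s])
  qed
  have name: "\<exists>t\<in>M. elems (val F t) = F'"
    if F': "is_generic F'" "hset F' \<in> gen_ext M A F" for F F'
  proof -
    have "countable F'"
      using generic_facts(1)[OF F'(1)] countable_elems countable_subset by blast
    moreover obtain t where "t \<in> M" "val F t = hset F'"
      using F'(2) unfolding gen_ext_def by auto
    ultimately show ?thesis by (intro bexI[of _ t]) simp_all
  qed
  obtain s where s: "s \<in> M" "elems (val G s) = H"
    using name[OF H, of G] in_ext[OF H] A_in ext by auto
  obtain t where t: "t \<in> M" "elems (val H t) = G"
    using name[OF G, of H] in_ext[OF G] A_in ext by auto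
  obtain f where f: "f \<in> M" "is_function f A A"
    "\<And>F a. is_generic F \<Longrightarrow> a \<in> elems A \<Longrightarrow> app f a \<in> F \<longleftrightarrow> a \<in> elems (val F s)"
    using ex_boolean_values[OF s(1)] by blast
  obtain g where g: "g \<in> M" "is_function g A A"
    "\<And>F a. is_generic F \<Longrightarrow> a \<in> elems A \<Longrightarrow> app g a \<in> F \<longleftrightarrow> a \<in> elems (val F t)"
    using ex_boolean_values[OF t(1)] by blast
  show ?thesis
    by (rule generic_filters_equal[OF rigid f(1,2) g(1,2) G H])
      (simp_all add: f(3)[OF G] g(3)[OF H] s(2) t(2))
qed

end

section \<open>Finite modifications of reals\<close>

lemma (in base_model) finite_union_closed:
  "finite Z \<Longrightarrow> Z \<subseteq> M \<Longrightarrow> x \<in> M \<Longrightarrow> hset (elems x \<union> Z) \<in> M"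
proof (induction Z rule: finite_induct)
  case (insert z Z)
  then have "hset (insert z (elems (hset (elems x \<union> Z)))) \<in> M"
    by (intro insert_closed) auto
  then show ?case using insert.hyps(1) by (simp add: countable_finite)
qed simp

lemma (in base_model) finite_diff_closed:
  "finite Z \<Longrightarrow> Z \<subseteq> M \<Longrightarrow> x \<in> M \<Longrightarrow> hset (elems x - Z) \<in> M"
proof (induction Z rule: finite_induct)
  case (insert z Z)
  then have "hset (elems (hset (elems x - Z)) - {z}) \<in> M"
    by (intro remove_closed) auto
  moreover have "elems x - Z - {z} = elems x - insert z Z" by blast
  ultimately show ?case by simp
qed simp

lemma elems_baire:
  assumes "x \<in> baire"
  shows "elems x = range (\<lambda>n. kpair (nat_hc n) (app x (nat_hc n)))"
proof -
  have om: "elems omega = range nat_hc" by (simp add: omega_def)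
  have x: "is_function x omega omega" using assms by (simp add: baire_def)
  have app: "kpair (nat_hc n) y \<in> elems x \<longleftrightarrow> y = app x (nat_hc n)" for n y
    using app_eqI(2)[OF x] om by simp
  show ?thesis
  proof (intro equalityI subsetI)
    fix z assume z: "z \<in> elems x"
    have "\<exists>a\<in>elems omega. \<exists>y\<in>elems omega. z = kpair a y"
      using x z by (simp add: is_function_def)
    then obtain n y where "z = kpair (nat_hc n) y"
      unfolding om by auto
    moreover from this have "y = app x (nat_hc n)"
      using app z by simp
    ultimately show "z \<in> range (\<lambda>n. kpair (nat_hc n) (app x (nat_hc n)))"
      by simp
  qed (use app in auto)
qed

text \<open>As sets of pairs, \<open>x\<close> and \<open>y\<close> differ by finitely many
  elements, all of which lie in \<open>M\<close>; removing and adding them one at a time leads from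
  \<open>x\<close> to \<open>y\<close>.\<close>

lemma (in base_model) E0_closed:
  assumes x: "x \<in> M" "x \<in> baire" and y: "y \<in> baire" and "E0 x y"
  shows "y \<in> M"
proof -
  define X where "X z n = kpair (nat_hc n) (app z (nat_hc n))" for z n
  have ex: "elems x = range (X x)" and ey: "elems y = range (X y)"
    using elems_baire x(2) y by (simp_all add: X_def)
  define D where "D = {n. app x (nat_hc n) \<noteq> app y (nat_hc n)}"
  have D: "finite D"
    using assms(4) by (simp add: E0_def D_def eventually_cofinite)
  have "X x n = X y n" if "n \<notin> D" for n
    using that by (simp add: D_def X_def)
  then have "elems x - elems y \<subseteq> X x ` D" "elems y - elems x \<subseteq> X y ` D"
    unfolding ex ey by (auto simp: image_iff) metis+
  then have fin: "finite (elems x - elems y)" "finite (elems y - elems x)"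
    using D finite_subset by blast+
  \<comment> \<open>The numerals are available in \<open>M\<close> as first components of the
    elements of \<open>x\<close>.\<close>
  have nat: "nat_hc n \<in> M" for n
  proof -
    have "X x n \<in> M" using ex elem_closed[OF x(1)] by blast
    then show ?thesis unfolding X_def by (rule transitive_set_kpairD[OF transitive])
  qed
  have "app y (nat_hc n) \<in> elems omega" for n
    using y by (intro app_eqI(1)[of y omega]) (simp_all add: baire_def omega_def)
  then have "X y n \<in> M" for n
    using nat kpair_closed unfolding X_def omega_def
    by (simp add: image_iff) metis
  then have yM: "elems y \<subseteq> M" unfolding ey by blast
  have xM: "elems x \<subseteq> M" using elem_closed[OF x(1)] by blast
  have "hset (elems x - (elems x - elems y)) \<in> M"
    by (rule finite_diff_closed) (use fin xM x(1) in auto)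
  then have "hset (elems (hset (elems x - (elems x - elems y))) \<union> (elems y - elems x)) \<in> M"
    by (intro finite_union_closed) (use fin yM in auto)
  moreover have "elems x - (elems x - elems y) \<union> (elems y - elems x) = elems y" by blast
  ultimately show ?thesis by simp
qed

lemma base_modelI: "transitive_set N \<Longrightarrow> models N S \<Longrightarrow> base_axioms \<subseteq> S \<Longrightarrow> base_model N"
  by unfold_locales (auto simp: models_def)

lemma adjoin_subset_if_E0:
  assumes "base_axioms \<subseteq> S" "x \<in> baire" "y \<in> baire" "E0 x y"
  shows "adjoin S M y \<subseteq> adjoin S M x"
proof -
  have "y \<in> N" if "transitive_set N" "models N S" "x \<in> N" for N
    using base_model.E0_closed[OF base_modelI[OF that(1,2) assms(1)] that(3) assms(2-4)] .
  then show ?thesis unfolding adjoin_def by blast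
qed

lemma E0_sym: "E0 x y \<Longrightarrow> E0 y x"
  by (simp add: E0_def eq_commute)

lemma E0_refl: "E0 x x"
  by (simp add: E0_def)

lemma E0_iff_eventually: "E0 x y \<longleftrightarrow> (\<exists>N. \<forall>n>N. app x (nat_hc n) = app y (nat_hc n))"
  by (simp add: E0_def MOST_nat)

text \<open>The fragment \<open>T0\<close> is required below \<open>S\<close>, hence also below
  \<open>T\<close>: the rigidity argument takes place in \<open>M\<close>, a model of
  \<open>T\<close>, while the finite modifications are carried out in arbitrary transitive models of
  \<open>S\<close>.\<close>

theorem proposition4:
  shows "\<exists>T0. finite T0 \<and> T0 \<subseteq> ZFC \<and>
    (\<forall>S T M A R xdot.
       T0 \<subseteq> S \<and> S \<subseteq> T \<and> T \<subseteq> ZFC \<and>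
       ctm T M \<and>
       kpair A R \<in> M \<and> complete_boolean_algebra_in M A R \<and> rigid_in M A R \<and>
       xdot \<in> M \<and> is_name A xdot \<and>
       (\<forall>G. generic M A R G \<longrightarrow>
          val G xdot \<in> baire \<and> gen_ext M A G = adjoin S M (val G xdot))
     \<longrightarrow>
       (\<forall>G H. generic M A R G \<and> generic M A R H \<longrightarrow>
          (adjoin S M (val G xdot) = adjoin S M (val H xdot) \<longleftrightarrow> val G xdot = val H xdot) \<and>
          (val G xdot = val H xdot \<longleftrightarrow> E0 (val G xdot) (val H xdot)) \<and>
          (adjoin S M (val G xdot) = adjoin S M (val H xdot) \<longleftrightarrow>
             (\<exists>N. \<forall>n>N. app (val G xdot) (nat_hc n) = app (val H xdot) (nat_hc n)))))"
proof (rule exI[of _ base_axioms], intro conjI allI impI)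
  show "finite base_axioms" by (rule finite_base_axioms)
  show "base_axioms \<subseteq> ZFC" by (rule base_axioms_subset_ZFC)
next
  fix S T M A R xdot G H
  assume *: "base_axioms \<subseteq> S \<and> S \<subseteq> T \<and> T \<subseteq> ZFC \<and>
       ctm T M \<and>
       kpair A R \<in> M \<and> complete_boolean_algebra_in M A R \<and> rigid_in M A R \<and>
       xdot \<in> M \<and> is_name A xdot \<and>
       (\<forall>G. generic M A R G \<longrightarrow>
          val G xdot \<in> baire \<and> gen_ext M A G = adjoin S M (val G xdot))"
    and GH: "generic M A R G \<and> generic M A R H"
  let ?x = "val G xdot" and ?y = "val H xdot"
  have "base_model M"
    using * by (intro base_modelI[of M T]) (auto simp: ctm_def)
  then interpret forcing M A R
    using * by (simp add: forcing_def forcing_axioms_def ground_model_def ground_model_axioms_def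
        ctm_def)
  have S: "base_axioms \<subseteq> S" and rigid: "rigid_in M A R"
    and baire: "?x \<in> baire" "?y \<in> baire"
    and ext: "gen_ext M A G = adjoin S M ?x" "gen_ext M A H = adjoin S M ?y"
    using * GH by blast+
  have gen: "is_generic G" "is_generic H"
    using GH by (simp_all add: is_generic_def)
  \<comment> \<open>Since \<open>M\<close> is contained in \<open>adjoin S M ?x\<close>, the assumed
    equality with the generic extension yields a name of \<open>A\<close> without any check
    names.\<close>
  have "A \<in> gen_ext M A G"
    unfolding ext(1) adjoin_def using A_closed by blast
  then have "G = H" if "adjoin S M ?x = adjoin S M ?y"
    using generic_eq_if_same_extension[OF rigid gen] ext that by simp
  then have adjoin_imp_eq: "adjoin S M ?x = adjoin S M ?y \<longrightarrow> ?x = ?y"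
    by blast
  have E0_imp_adjoin: "E0 ?x ?y \<longrightarrow> adjoin S M ?x = adjoin S M ?y"
    using adjoin_subset_if_E0[OF S baire] adjoin_subset_if_E0[OF S baire(2,1)] E0_sym by blast
  have iff: "(adjoin S M ?x = adjoin S M ?y \<longleftrightarrow> ?x = ?y) \<and> (?x = ?y \<longleftrightarrow> E0 ?x ?y)"
    using adjoin_imp_eq E0_imp_adjoin E0_refl by metis
  then show "adjoin S M ?x = adjoin S M ?y \<longleftrightarrow> ?x = ?y" "?x = ?y \<longleftrightarrow> E0 ?x ?y" by blast+
  show "adjoin S M ?x = adjoin S M ?y \<longleftrightarrow>
      (\<exists>N. \<forall>n>N. app ?x (nat_hc n) = app ?y (nat_hc n))"
    using iff unfolding E0_iff_eventually[symmetric] by blast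
qed

end
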